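(* Let $\{\psi^\pm_{r-1/2}\}_{r\in\mathbb Z}$ be charged free fermions, satisfying $$\psi_k^\pm\psi_l^\pm+\psi_l^\pm\psi_k^\pm=0,\qquad \psi_k^+\psi_l^-+\psi_l^-\psi_k^+=\delta_{k,-l}\qquad(k,l\in\mathbb Z+\tfrac12).$$ Let $A=(A_{i,j})_{i,j\in\mathbb Z}$ and $B=(B_{i,j})_{i,j\in\mathbb Z}$ be two complex matrices such that for any fixed $i$, $A_{i,j}=0$ and $B_{i,j}=0$ for $j\ll0$. Set, for $k\in\mathbb Z$, $$\tilde\psi^+_{k-1/2}=\sum_{i\in\mathbb Z}A_{k,i}\,\psi^+_{i-1/2},\qquad \tilde\psi^-_{k-1/2}=\sum_{i\in\mathbb Z}B_{k,i}\,\psi^-_{i-1/2}.$$ Then $\{\tilde\psi^\pm_{r-1/2}\}_{r\in\mathbb Z}$ satisfy the anticommutation relations of charged free fermions (the relations above with $\tilde\psi$ in place of $\psi$) if and only if $(A^{-1})_{i,j}=B_{1-j,1-i}$.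
   Context: $A^{-1}$ denotes the (left) inverse of the infinite matrix $A$: one writes $C=A^{-1}$ if $\sum_{k\in\mathbb Z}C_{i,k}A_{k,j}=\delta_{i,j}$. $\Lambda=\mathbb C[p_1,p_2,\dots]$ is the ring of symmetric functions, with complete and elementary symmetric functions $h_k,e_k$; $f^\perp$ is the adjoint of multiplication by $f\in\Lambda$ for the scalar product in which Schur functions are orthonormal ($p_n^\perp=n\,\partial/\partial p_n$). Put $H(u)=\sum_{k\ge0}h_ku^k$, $E(u)=\sum_{k\ge0}e_ku^k$ (multiplication operators), $H^\perp(u)=\sum_{k\ge0}h_k^\perp u^{-k}$, $E^\perp(u)=\sum_{k\ge0}e_k^\perp u^{-k}$. The charged free fermions are the operators $\psi_i^\pm$ ($i\in\mathbb Z+\frac12$) on the boson Fock space $\mathcal B=\mathbb C[z,z^{-1}]\otimes\Lambda$ given by $\psi^\pm(u)=\sum_{i\in\mathbb Z+1/2}\psi^\pm_iu^{-i-1/2}$, where for $m\in\mathbb Z$, $f\in\Lambda$ $$\psi^+(u)(z^mf)=z^{m+1}u^mH(u)E^\perp(-u)(f),\qquad \psi^-(u)(z^mf)=z^{m-1}u^{-m}E(-u)H^\perp(u)(f).$$ For each $b\in\mathcal B$ one has $\psi_k^\pm(b)=0$ for $k\gg0$, so the operators $\tilde\psi^\pm_k$ are well defined.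
   Formalization: With C_{i,j}=B_{1-j,1-i}, the condition "(A^{-1})_{i,j}=B_{1-j,1-i}" is taken as AC=1 (sum over k of A_{i,k}C_{k,j}=δ_{i,j}) rather than CA=1; with CA=1 the claim fails, e.g. for A_{i,j}=δ_{j,2i}, B_{i,j}=δ_{j,2i-1}. *)

theory Defs
  imports Complex_Main "HOL-Library.Poly_Mapping"
begin

section \<open>The ring of symmetric functions\<close>

text \<open>Variable number \<open>i\<close> of this polynomial ring is the power sum \<open>p\<^bsub>i+1\<^esub>\<close>, so that
  the ring is \<open>\<complex>[p\<^sub>1, p\<^sub>2, \<dots>]\<close>.\<close>

type_synonym symfun = "(nat \<Rightarrow>\<^sub>0 nat) \<Rightarrow>\<^sub>0 complex"

definition sym_const :: "complex \<Rightarrow> symfun" where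
  "sym_const c = Poly_Mapping.single 0 c"

text \<open>\<open>p\<^sub>n\<close>, meant for \<open>n \<ge> 1\<close> only.\<close>

definition power_sum :: "nat \<Rightarrow> symfun" where
  "power_sum n = Poly_Mapping.single (Poly_Mapping.single (n - 1) 1) 1"

text \<open>Newton's identities \<open>n h\<^sub>n = \<Sum>\<^bsub>1\<le>i\<le>n\<^esub> p\<^sub>i h\<^bsub>n-i\<^esub>\<close> and
  \<open>n e\<^sub>n = \<Sum>\<^bsub>1\<le>i\<le>n\<^esub> (-1)\<^bsup>i-1\<^esup> p\<^sub>i e\<^bsub>n-i\<^esub>\<close> express the complete and elementary
  symmetric functions in the generators \<open>p\<^sub>i\<close>.\<close>

fun complete_sym :: "nat \<Rightarrow> symfun" where
  "complete_sym 0 = 1"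
| "complete_sym (Suc n) = sym_const (1 / of_nat (Suc n)) *
     (\<Sum>i\<le>n. power_sum (Suc i) * complete_sym (n - i))"

fun elementary_sym :: "nat \<Rightarrow> symfun" where
  "elementary_sym 0 = 1"
| "elementary_sym (Suc n) = sym_const (1 / of_nat (Suc n)) *
     (\<Sum>i\<le>n. (- 1) ^ i * power_sum (Suc i) * elementary_sym (n - i))"


section \<open>The scalar product and adjoints of multiplication operators\<close>

text \<open>The scalar product in which the Schur functions are orthonormal, written in the basis
  of the monomials \<open>p\<^sub>\<lambda>\<close> in the power sums: \<open>\<langle>p\<^sub>\<lambda>, p\<^sub>\<mu>\<rangle> = z\<^sub>\<lambda> \<delta>\<^bsub>\<lambda>\<mu>\<^esub>\<close> with
  \<open>z\<^sub>\<lambda> = \<Prod>\<^sub>n n\<^bsup>m(n)\<^esup> m(n)!\<close>, where \<open>m(n)\<close> is the exponent of \<open>p\<^sub>n\<close>. It is bilinear, not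
  sesquilinear.\<close>

definition z_weight :: "(nat \<Rightarrow>\<^sub>0 nat) \<Rightarrow> nat" where
  "z_weight m = (\<Prod>i\<in>Poly_Mapping.keys m.
     Suc i ^ Poly_Mapping.lookup m i * fact (Poly_Mapping.lookup m i))"

definition sym_inner :: "symfun \<Rightarrow> symfun \<Rightarrow> complex" where
  "sym_inner f g = (\<Sum>m\<in>Poly_Mapping.keys f.
     of_nat (z_weight m) * Poly_Mapping.lookup f m * Poly_Mapping.lookup g m)"

text \<open>\<open>perp f\<close> is the operator \<open>f\<^sup>\<bottom>\<close>. Existence of the adjoint is \<open>sym_inner_perp\<close> below, and
  \<open>perp_power_sum\<close> is the formula \<open>p\<^sub>n\<^sup>\<bottom> = n \<partial>/\<partial>p\<^sub>n\<close>.\<close>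

definition perp :: "symfun \<Rightarrow> symfun \<Rightarrow> symfun" where
  "perp f g = (THE w. \<forall>v. sym_inner w v = sym_inner g (f * v))"

lemma z_weight_pos: "z_weight m > 0"
  unfolding z_weight_def by (intro prod_pos) auto

lemma sym_inner_superset:
  assumes "finite S" "Poly_Mapping.keys f \<subseteq> S"
  shows "sym_inner f g = (\<Sum>m\<in>S.
     of_nat (z_weight m) * Poly_Mapping.lookup f m * Poly_Mapping.lookup g m)"
  unfolding sym_inner_def
  by (rule sum.mono_neutral_left) (use assms in \<open>auto simp: in_keys_iff\<close>)

lemma sym_inner_single_right:
  "sym_inner f (Poly_Mapping.single m c) = of_nat (z_weight m) * Poly_Mapping.lookup f m * c"
proof -
  have "sym_inner f (Poly_Mapping.single m c) = (\<Sum>k\<in>insert m (Poly_Mapping.keys f).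
     of_nat (z_weight k) * Poly_Mapping.lookup f k * Poly_Mapping.lookup (Poly_Mapping.single m c) k)"
    by (rule sym_inner_superset) auto
  also have "\<dots> = (\<Sum>k\<in>insert m (Poly_Mapping.keys f).
     if k = m then of_nat (z_weight m) * Poly_Mapping.lookup f m * c else 0)"
    by (rule sum.cong) (auto simp: lookup_single when_def)
  finally show ?thesis by simp
qed

lemma sym_inner_nondegenerate:
  assumes "\<And>v. sym_inner f v = sym_inner g v"
  shows "f = g"
proof (rule poly_mapping_eqI)
  fix m
  have "sym_inner f (Poly_Mapping.single m 1) = sym_inner g (Poly_Mapping.single m 1)"
    by (rule assms)
  then show "Poly_Mapping.lookup f m = Poly_Mapping.lookup g m"
    using z_weight_pos[of m] by (simp add: sym_inner_single_right)
qed

lemma sym_inner_add_left: "sym_inner (f + g) v = sym_inner f v + sym_inner g v"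
proof -
  let ?S = "Poly_Mapping.keys f \<union> Poly_Mapping.keys g"
  have k: "Poly_Mapping.keys (f + g) \<subseteq> ?S" by (rule Poly_Mapping.keys_add)
  show ?thesis
    by (subst (1 2 3) sym_inner_superset[of ?S])
      (use k in \<open>auto simp: lookup_add algebra_simps sum.distrib\<close>)
qed

lemma sym_inner_add_right: "sym_inner v (f + g) = sym_inner v f + sym_inner v g"
  by (simp add: sym_inner_def lookup_add algebra_simps sum.distrib)

lemma symfun_induct [case_names zero single add]:
  fixes f :: symfun
  assumes "P 0" and "\<And>m c. P (Poly_Mapping.single m c)" and "\<And>f g. P f \<Longrightarrow> P g \<Longrightarrow> P (f + g)"
  shows "P f"
proof (induction f rule: update_induct)
  case const
  then show ?case using assms(1) by simp
next
  case (update f a b)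
  have "Poly_Mapping.update a b f = f + Poly_Mapping.single a b"
    by (rule poly_mapping_eqI)
      (use update in \<open>auto simp: lookup_update lookup_add lookup_single when_def in_keys_iff\<close>)
  then show ?case using assms(2,3) update by simp
qed

lemma sym_inner_single_left:
  "sym_inner (Poly_Mapping.single m c) f = of_nat (z_weight m) * c * Poly_Mapping.lookup f m"
  by (cases "c = 0") (auto simp: sym_inner_def)

lemma perp_unique:
  assumes "\<And>v. sym_inner w v = sym_inner g (f * v)"
  shows "perp f g = w"
  unfolding perp_def
  by (rule the_equality) (auto intro!: sym_inner_nondegenerate simp: assms)

lemma adjoint_exists: "\<exists>w. \<forall>v. sym_inner w v = sym_inner g (f * v)"
proof (induction f rule: symfun_induct)
  case zero
  have "sym_inner 0 v = sym_inner g (0 * v)" for v by (simp add: sym_inner_def)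
  then show ?case by blast
next
  case (add f1 f2)
  then obtain w1 w2 where
    "\<And>v. sym_inner w1 v = sym_inner g (f1 * v)" "\<And>v. sym_inner w2 v = sym_inner g (f2 * v)"
    by blast
  then have "sym_inner (w1 + w2) v = sym_inner g ((f1 + f2) * v)" for v
    by (simp add: sym_inner_add_left sym_inner_add_right distrib_right)
  then show ?case by blast
next
  case (single a c)
  show ?case
  proof (induction g rule: symfun_induct)
    case zero
    have "sym_inner 0 v = sym_inner 0 (Poly_Mapping.single a c * v)" for v
      by (simp add: sym_inner_def)
    then show ?case by blast
  next
    case (add g1 g2)
    then obtain w1 w2 where
      "\<And>v. sym_inner w1 v = sym_inner g1 (Poly_Mapping.single a c * v)"
      "\<And>v. sym_inner w2 v = sym_inner g2 (Poly_Mapping.single a c * v)"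
      by blast
    then have "sym_inner (w1 + w2) v = sym_inner (g1 + g2) (Poly_Mapping.single a c * v)" for v
      by (simp add: sym_inner_add_left)
    then show ?case by blast
  next
    case (single b d)
    show ?case
    proof (cases "\<exists>n. b = a + n")
      case True
      then obtain n where n: "b = a + n" by blast
      define w where
        "w = Poly_Mapping.single n (c * d * of_nat (z_weight b) / of_nat (z_weight n))"
      have "sym_inner w v = sym_inner (Poly_Mapping.single b d) (Poly_Mapping.single a c * v)" for v
      proof (induction v rule: symfun_induct)
        case zero
        then show ?case by (simp add: sym_inner_def)
      next
        case (single m x)
        then show ?case using z_weight_pos[of n]
          by (simp add: w_def sym_inner_single_left mult_single lookup_single when_def n)
      next
        case (add f g)
        then show ?case by (simp add: sym_inner_add_right distrib_left)
      qed
      then show ?thesis by blast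
    next
      case False
      have "sym_inner 0 v = sym_inner (Poly_Mapping.single b d) (Poly_Mapping.single a c * v)" for v
      proof (induction v rule: symfun_induct)
        case zero
        then show ?case by (simp add: sym_inner_def)
      next
        case (single m x)
        then show ?case using False
          by (auto simp: sym_inner_single_left sym_inner_def mult_single lookup_single when_def)
      next
        case (add f g)
        then show ?case by (simp add: sym_inner_add_right distrib_left)
      qed
      then show ?thesis by blast
    qed
  qed
qed

lemma sym_inner_perp: "sym_inner (perp f g) v = sym_inner g (f * v)"
proof -
  obtain w where "\<And>v. sym_inner w v = sym_inner g (f * v)" using adjoint_exists by blast
  then show ?thesis using perp_unique by metis
qed

lemma z_weight_add_single:
  "z_weight (m + Poly_Mapping.single i 1) = Suc i * Suc (Poly_Mapping.lookup m i) * z_weight m"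
proof -
  let ?K = "insert i (Poly_Mapping.keys m)"
  let ?g = "\<lambda>m j. Suc j ^ Poly_Mapping.lookup m j * fact (Poly_Mapping.lookup m j) :: nat"
  have k: "Poly_Mapping.keys (m + Poly_Mapping.single i 1) \<subseteq> ?K"
    using Poly_Mapping.keys_add[of m "Poly_Mapping.single i 1"] by auto
  have w: "z_weight n = prod (?g n) ?K" if "Poly_Mapping.keys n \<subseteq> ?K" for n
    unfolding z_weight_def
    by (rule prod.mono_neutral_left) (use that in \<open>auto simp: in_keys_iff\<close>)
  have "prod (?g (m + Poly_Mapping.single i 1)) (?K - {i}) = prod (?g m) (?K - {i})"
    by (rule prod.cong) (auto simp: lookup_add lookup_single when_def)
  then show ?thesis
    by (subst (1 2) w)
      (use k in \<open>auto simp: prod.remove[of ?K i] lookup_add algebra_simps simp del: insert_Diff_single\<close>)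
qed

definition sym_deriv :: "nat \<Rightarrow> symfun \<Rightarrow> symfun" where
  "sym_deriv n f = (\<Sum>m\<in>Poly_Mapping.keys f.
     Poly_Mapping.single (m - Poly_Mapping.single (n - 1) 1)
       (of_nat (Poly_Mapping.lookup m (n - 1)) * Poly_Mapping.lookup f m))"

lemma perp_power_sum:
  assumes "n \<ge> 1"
  shows "perp (power_sum n) f = of_nat n * sym_deriv n f"
proof (rule perp_unique)
  fix v
  obtain i where i: "n = Suc i" using assms by (cases n) auto
  let ?e = "Poly_Mapping.single i 1 :: nat \<Rightarrow>\<^sub>0 nat"
  have of_nat_mult_inner: "sym_inner (of_nat k * f) v = of_nat k * sym_inner f v" for k f v
    by (induction k) (simp_all add: sym_inner_add_left algebra_simps, simp add: sym_inner_def)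
  have deriv_add: "sym_deriv n (f + g) = sym_deriv n f + sym_deriv n g" for f g
  proof -
    let ?S = "Poly_Mapping.keys f \<union> Poly_Mapping.keys g"
    let ?t = "\<lambda>f m. Poly_Mapping.single (m - Poly_Mapping.single (n - 1) 1)
       (of_nat (Poly_Mapping.lookup m (n - 1)) * Poly_Mapping.lookup f m) :: symfun"
    have s: "sym_deriv n h = sum (?t h) ?S" if "Poly_Mapping.keys h \<subseteq> ?S" for h
      unfolding sym_deriv_def
      by (rule sum.mono_neutral_left) (use that in \<open>auto simp: in_keys_iff\<close>)
    have "sum (?t (f + g)) ?S = sum (?t f) ?S + sum (?t g) ?S"
      by (simp add: lookup_add distrib_left single_add sum.distrib)
    then show ?thesis
      using s[of f] s[of g] s[OF Poly_Mapping.keys_add] by simp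
  qed
  show "sym_inner (of_nat n * sym_deriv n f) v = sym_inner f (power_sum n * v)"
  proof (induction f rule: symfun_induct)
    case zero
    then show ?case by (simp add: sym_inner_def sym_deriv_def)
  next
    case (add f g)
    then show ?case by (simp add: deriv_add distrib_left sym_inner_add_left)
  next
    case (single b d)
    have D: "sym_deriv n (Poly_Mapping.single b d) =
        Poly_Mapping.single (b - ?e) (of_nat (Poly_Mapping.lookup b i) * d)"
      by (cases "d = 0") (auto simp: sym_deriv_def i)
    show ?case
    proof (induction v rule: symfun_induct)
      case zero
      then show ?case by (simp add: sym_inner_def)
    next
      case (add f g)
      then show ?case by (simp add: sym_inner_add_right distrib_left)
    next
      case (single m x)
      show ?case
      proof (cases "Poly_Mapping.lookup b i = 0")
        case True
        have "b \<noteq> ?e + m"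
        proof
          assume "b = ?e + m"
          then have "Poly_Mapping.lookup b i = Poly_Mapping.lookup (?e + m) i" by simp
          then show False using True by (simp add: lookup_add)
        qed
        then have "sym_inner (Poly_Mapping.single b d) (power_sum n * Poly_Mapping.single m x) = 0"
          by (auto simp: power_sum_def i mult_single sym_inner_single_left lookup_single when_def)
        moreover have "sym_inner (of_nat n * sym_deriv n (Poly_Mapping.single b d))
            (Poly_Mapping.single m x) = 0"
          unfolding of_nat_mult_inner D by (simp add: True sym_inner_def)
        ultimately show ?thesis by simp
      next
        case False
        define c where "c = b - ?e"
        have b: "b = c + ?e"
          by (rule poly_mapping_eqI)
            (use False in \<open>auto simp: c_def lookup_add lookup_minus lookup_single when_def\<close>)
        have c: "b - ?e = c" by (simp add: c_def)
        have bi: "Poly_Mapping.lookup b i = Suc (Poly_Mapping.lookup c i)"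
          by (simp add: b lookup_add)
        have zb: "z_weight b = Suc i * Suc (Poly_Mapping.lookup c i) * z_weight c"
          unfolding b by (rule z_weight_add_single)
        have bm: "(?e + m = b) \<longleftrightarrow> (m = c)" by (auto simp: b add.commute)
        have l: "sym_inner (of_nat n * sym_deriv n (Poly_Mapping.single b d))
            (Poly_Mapping.single m x) = of_nat (z_weight b) * d * (if m = c then x else 0)"
          unfolding of_nat_mult_inner D c sym_inner_single_left bi zb
          by (simp add: i lookup_single when_def algebra_simps)
        have p: "power_sum n * Poly_Mapping.single m x = Poly_Mapping.single (?e + m) x"
          by (simp add: power_sum_def i mult_single)
        have r: "sym_inner (Poly_Mapping.single b d) (power_sum n * Poly_Mapping.single m x) =
            of_nat (z_weight b) * d * (if m = c then x else 0)"
          unfolding p sym_inner_single_left lookup_single bm when_def by simp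
        show ?thesis unfolding l r ..
      qed
    qed
  qed
qed

section \<open>Boson Fock space and charged free fermions\<close>

text \<open>\<open>\<complex>[z, z\<^bsup>-1\<^esup>] \<otimes> \<Lambda>\<close> as Laurent polynomials in \<open>z\<close> with coefficients in \<open>\<Lambda>\<close>:
  \<open>Poly_Mapping.single m f\<close> is \<open>z\<^sup>m f\<close>.\<close>

type_synonym fock = "int \<Rightarrow>\<^sub>0 symfun"

definition fock_scale :: "complex \<Rightarrow> fock \<Rightarrow> fock" where
  "fock_scale c b = Poly_Mapping.single 0 (sym_const c) * b"

text \<open>The coefficients of \<open>u\<^sup>n\<close> in \<open>H(u) E\<^sup>\<bottom>(-u) f\<close> and in \<open>E(-u) H\<^sup>\<bottom>(u) f\<close>. Only finitely many
  summands are nonzero, as \<open>e\<^sub>k\<^sup>\<bottom> f = h\<^sub>k\<^sup>\<bottom> f = 0\<close> for large \<open>k\<close>.\<close>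

definition HE_coeff :: "int \<Rightarrow> symfun \<Rightarrow> symfun" where
  "HE_coeff n f = Sum_any (\<lambda>(j, k). if int j - int k = n
     then complete_sym j * ((- 1) ^ k * perp (elementary_sym k) f) else 0)"

definition EH_coeff :: "int \<Rightarrow> symfun \<Rightarrow> symfun" where
  "EH_coeff n f = Sum_any (\<lambda>(j, k). if int j - int k = n
     then (- 1) ^ j * elementary_sym j * perp (complete_sym k) f else 0)"

text \<open>Half-integer modes are indexed by the integer above: \<open>psi_plus k\<close> is \<open>\<psi>\<^sup>+\<^bsub>k-1/2\<^esub>\<close>, the
  coefficient of \<open>u\<^bsup>-k\<^esup>\<close> in \<open>\<psi>\<^sup>+(u)\<close>, and likewise for \<open>psi_minus\<close>. The factors \<open>u\<^sup>m\<close> and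
  \<open>u\<^bsup>-m\<^esup>\<close> in the definition of \<open>\<psi>\<^sup>\<plusminus>(u)(z\<^sup>m f)\<close> account for the shift by \<open>m\<close>.\<close>

definition psi_plus :: "int \<Rightarrow> fock \<Rightarrow> fock" where
  "psi_plus k b = (\<Sum>m\<in>Poly_Mapping.keys b.
     Poly_Mapping.single (m + 1) (HE_coeff (- k - m) (Poly_Mapping.lookup b m)))"

definition psi_minus :: "int \<Rightarrow> fock \<Rightarrow> fock" where
  "psi_minus k b = (\<Sum>m\<in>Poly_Mapping.keys b.
     Poly_Mapping.single (m - 1) (EH_coeff (- k + m) (Poly_Mapping.lookup b m)))"

text \<open>In the shifted indexing \<open>\<delta>\<^bsub>k-1/2, -(l-1/2)\<^esub>\<close> is \<open>1\<close> iff \<open>k + l = 1\<close>.\<close>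

definition charged_free_fermions :: "(int \<Rightarrow> fock \<Rightarrow> fock) \<Rightarrow> (int \<Rightarrow> fock \<Rightarrow> fock) \<Rightarrow> bool" where
  "charged_free_fermions P M \<longleftrightarrow> (\<forall>k l b.
     P k (P l b) + P l (P k b) = 0 \<and>
     M k (M l b) + M l (M k b) = 0 \<and>
     P k (M l b) + M l (P k b) = (if k + l = 1 then b else 0))"

text \<open>\<open>\<Sum>\<^sub>i A\<^bsub>k,i\<^esub> \<psi>\<^bsub>i-1/2\<^esub>\<close>. Applied to a vector the sum is finite when \<open>A\<^bsub>k,i\<^esub> = 0\<close> for
  \<open>i \<lless> 0\<close>, since \<open>\<psi>\<^bsub>i-1/2\<^esub>\<close> kills the vector for \<open>i \<ggreater> 0\<close>.\<close>

definition fermion_transform ::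
  "(int \<Rightarrow> int \<Rightarrow> complex) \<Rightarrow> (int \<Rightarrow> fock \<Rightarrow> fock) \<Rightarrow> int \<Rightarrow> fock \<Rightarrow> fock" where
  "fermion_transform A \<psi> k b = Sum_any (\<lambda>i. fock_scale (A k i) (\<psi> i b))"


section \<open>Infinite matrices\<close>

definition rows_bounded_below :: "(int \<Rightarrow> int \<Rightarrow> complex) \<Rightarrow> bool" where
  "rows_bounded_below A \<longleftrightarrow> (\<forall>i. \<exists>N. \<forall>j<N. A i j = 0)"

text \<open>\<open>X\<close> is a left inverse of \<open>Y\<close>. The order of the factors matters: for
  \<open>A\<^bsub>i,j\<^esub> = \<delta>\<^bsub>j,2i\<^esub>\<close> and \<open>B\<^bsub>i,j\<^esub> = \<delta>\<^bsub>j,2i-1\<^esub>\<close> the transformed operators are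
  \<open>\<psi>\<^sup>+\<^bsub>2k-1/2\<^esub>\<close> and \<open>\<psi>\<^sup>-\<^bsub>2k-3/2\<^esub>\<close>, which do satisfy the relations of charged free fermions.
  With \<open>C\<^bsub>i,j\<^esub> = B\<^bsub>1-j,1-i\<^esub> = \<delta>\<^bsub>i,2j\<^esub>\<close> one has \<open>A C = 1\<close>, but \<open>(C A)\<^bsub>i,i\<^esub> = 0\<close> for odd \<open>i\<close>.
  So "\<open>C\<close> is the inverse of \<open>A\<close>" has to be read as \<open>matrix_left_inverse A C\<close>.\<close>

definition matrix_left_inverse ::
  "(int \<Rightarrow> int \<Rightarrow> complex) \<Rightarrow> (int \<Rightarrow> int \<Rightarrow> complex) \<Rightarrow> bool" where
  "matrix_left_inverse X Y \<longleftrightarrow> (\<forall>i j. finite {k. X i k * Y k j \<noteq> 0} \<and>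
     Sum_any (\<lambda>k. X i k * Y k j) = (if i = j then 1 else 0))"

end

theory Submission
  imports Defs
begin

text \<open>For the untransformed fermions, commuting the annihilation half of one vertex operator past
  the
  creation half of another yields a factor \<open>(1 - v/u)\<^bsup>\<plusminus>1\<^esup>\<close> times a normally ordered product that is
  symmetric in the two operators. For equal charges the factor is \<open>1 - v/u\<close>, and the modes
  anticommute by antisymmetry. For opposite charges the two expansions of \<open>1 / (1 - v/u)\<close> add up
    to a
  delta function at \<open>u = v\<close>, where \<open>H(u) E(-u) = 1\<close> collapses the normally ordered product.

  Given these relations, on every vector the transformed modes involve only finitely many terms, so
  the anticommutator of \<open>\<psi>\<^sup>+\<close>-mode \<open>k\<close> with \<open>\<psi>\<^sup>-\<close>-mode \<open>l\<close> is the scalar \<open>\<Sum>\<^sub>i A\<^bsub>k,i\<^esub> B\<^bsub>l,1-i\<^esub>\<close>, an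
    entry
  of the matrix product of \<open>A\<close> and \<open>(B\<^bsub>1-j,1-i\<^esub>)\<^bsub>i,j\<^esub>\<close>.\<close>

section \<open>Linearity of the adjoint\<close>

lemma sym_inner_scale_left: "sym_inner (sym_const c * f) v = c * sym_inner f v"
proof (induction f rule: symfun_induct)
  case zero
  then show ?case by (simp add: sym_inner_def)
next
  case (single m x)
  then show ?case
    by (simp add: sym_const_def mult_single sym_inner_single_left)
next
  case (add f g)
  then show ?case by (simp add: distrib_left sym_inner_add_left)
qed

lemma sym_inner_scale_right: "sym_inner f (sym_const c * v) = c * sym_inner f v"
proof (induction v rule: symfun_induct)
  case zero
  then show ?case by (simp add: sym_inner_def)
next
  case (single m x)
  then show ?case
    by (simp add: sym_const_def mult_single sym_inner_single_right)
next
  case (add f g)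
  then show ?case by (simp add: distrib_left sym_inner_add_right)
qed

lemma perp_add: "perp f (x + y) = perp f x + perp f y"
  by (rule perp_unique) (simp add: sym_inner_add_left sym_inner_perp)

lemma perp_scale: "perp f (sym_const c * x) = sym_const c * perp f x"
  by (rule perp_unique) (simp add: sym_inner_scale_left sym_inner_perp)

lemma perp_scale_left: "perp (sym_const c * f) x = sym_const c * perp f x"
  by (rule perp_unique)
    (simp add: sym_inner_scale_left sym_inner_perp mult.assoc sym_inner_scale_right)

lemma perp_add_left: "perp (f + g) x = perp f x + perp g x"
  by (rule perp_unique)
    (simp add: sym_inner_add_left sym_inner_add_right sym_inner_perp distrib_right)

text \<open>Adjunction reverses products, and commutativity of the ring undoes the reversal; hence
  all adjoints commute.\<close>

lemma perp_mult: "perp (f * g) x = perp f (perp g x)"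
  by (rule perp_unique) (simp add: sym_inner_perp mult.assoc mult.left_commute)

lemma perp_commute: "perp f (perp g x) = perp g (perp f x)"
  by (metis perp_mult mult.commute)

lemma perp_one [simp]: "perp 1 x = x"
  by (rule perp_unique) simp

lemma perp_zero [simp]: "perp f 0 = 0"
  by (rule perp_unique) (simp add: sym_inner_def)

lemma perp_zero_left [simp]: "perp 0 x = 0"
  by (rule perp_unique) (simp add: sym_inner_def)

lemma perp_minus: "perp f (- x) = - perp f x"
  using perp_add[of f x "- x"] by (simp add: eq_neg_iff_add_eq_0 add.commute)

lemma perp_diff: "perp f (x - y) = perp f x - perp f y"
  using perp_add[of f x "- y"] by (simp add: perp_minus)

lemma perp_minus_left: "perp (- f) x = - perp f x"
  using perp_add_left[of f "- f" x] by (simp add: eq_neg_iff_add_eq_0 add.commute)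

lemma perp_sum: "perp f (sum g S) = (\<Sum>i\<in>S. perp f (g i))"
  by (induction S rule: infinite_finite_induct) (auto simp: perp_add)

lemma perp_sum_left: "perp (sum f S) x = (\<Sum>i\<in>S. perp (f i) x)"
  by (induction S rule: infinite_finite_induct) (auto simp: perp_add_left)

lemma sym_const_one: "sym_const 1 = 1"
  by (simp add: sym_const_def)

lemma sym_const_of_nat: "sym_const (of_nat n) = of_nat n"
  by (simp add: sym_const_def)

lemma sym_const_mult: "sym_const (c * d) = sym_const c * sym_const d"
  by (simp add: sym_const_def mult_single)

lemma perp_of_nat_left: "perp (of_nat n * f) x = of_nat n * perp f x"
  using perp_scale_left[of "of_nat n" f x] by (simp add: sym_const_of_nat)

section \<open>Adjoints of power sums as derivations\<close>

lemma perp_power_sum_single: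
  "perp (power_sum (Suc i)) (Poly_Mapping.single b d) =
    Poly_Mapping.single (b - Poly_Mapping.single i 1)
      (of_nat (Suc i) * of_nat (Poly_Mapping.lookup b i) * d)"
  by (subst perp_power_sum)
    (auto simp: sym_deriv_def mult_single algebra_simps simp flip: single_of_nat)

text \<open>The operator is a multiple of a partial derivative. Additivity in both arguments reduces
  the Leibniz rule to monomials, where it says that exponents add.\<close>

lemma perp_power_sum_mult:
  "perp (power_sum (Suc i)) (f * g) =
    perp (power_sum (Suc i)) f * g + f * perp (power_sum (Suc i)) g"
proof (induction f rule: symfun_induct)
  case (single a c)
  show ?case
  proof (induction g rule: symfun_induct)
    case (single b d)
    let ?e = "Poly_Mapping.single i 1 :: nat \<Rightarrow>\<^sub>0 nat"
    \<comment> \<open>Subtraction of exponents is truncated, so \<open>?e\<close> may be moved onto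
      a factor only if that factor contains variable \<open>i\<close>; hence the case
      distinctions.\<close>
    have sub: "a + b - ?e = (a - ?e) + b" if "Poly_Mapping.lookup a i \<noteq> 0" for a b
      by (rule poly_mapping_eqI)
        (use that in \<open>auto simp: lookup_add lookup_minus lookup_single when_def\<close>)
    note [simp] = perp_power_sum_single mult_single lookup_add
    show ?case
    proof (cases "Poly_Mapping.lookup a i = 0")
      case a: True
      show ?thesis
      proof (cases "Poly_Mapping.lookup b i = 0")
        case True
        then show ?thesis using a by simp
      next
        case False
        have "a + b - ?e = a + (b - ?e)"
          using sub[of b a, OF False] by (simp add: add.commute)
        then show ?thesis using a by (simp add: algebra_simps)
      qed
    next
      case a: False
      show ?thesis
      proof (cases "Poly_Mapping.lookup b i = 0")
        case True
        then show ?thesis using sub[OF a, of b]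
          by (simp add: mult.assoc mult.left_commute mult.commute add.commute[of b])
      next
        case False
        have "a + b - ?e = a + (b - ?e)"
          using sub[of b a, OF False] by (simp add: add.commute)
        moreover have "a + (b - ?e) = a - ?e + b"
          using sub[of a b, OF a] calculation by simp
        ultimately show ?thesis
          by (simp add: single_add[symmetric] algebra_simps)
      qed
    qed
  next
    case (add f g)
    then show ?case by (simp add: distrib_left perp_add algebra_simps)
  qed simp
next
  case (add f1 f2)
  then show ?case by (simp add: distrib_right perp_add algebra_simps)
qed simp

lemma perp_power_sum_power_sum:
  "perp (power_sum (Suc i)) (power_sum (Suc j)) = (if i = j then of_nat (Suc i) else 0)"
  by (auto simp: power_sum_def[of "Suc j"] perp_power_sum_single lookup_single
      simp flip: single_of_nat)

section \<open>Local nilpotency of the adjoint operators\<close>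

text \<open>The degree of the monomial as a symmetric function: variable \<open>i\<close> is a power
  sum of degree \<open>Suc i\<close>.\<close>

definition mon_weight :: "(nat \<Rightarrow>\<^sub>0 nat) \<Rightarrow> nat" where
  "mon_weight m = (\<Sum>i\<in>Poly_Mapping.keys m. Suc i * Poly_Mapping.lookup m i)"

lemma mon_weight_superset:
  assumes "finite S" "Poly_Mapping.keys m \<subseteq> S"
  shows "mon_weight m = (\<Sum>i\<in>S. Suc i * Poly_Mapping.lookup m i)"
  unfolding mon_weight_def
  by (rule sum.mono_neutral_left) (use assms in \<open>auto simp: in_keys_iff\<close>)

lemma mon_weight_add: "mon_weight (m + n) = mon_weight m + mon_weight n"
proof -
  let ?S = "Poly_Mapping.keys m \<union> Poly_Mapping.keys n"
  have "Poly_Mapping.keys (m + n) \<subseteq> ?S" by (rule Poly_Mapping.keys_add)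
  then show ?thesis
    by (subst (1 2 3) mon_weight_superset[of ?S])
      (auto simp: lookup_add algebra_simps sum.distrib)
qed

definition order_ge :: "nat \<Rightarrow> symfun \<Rightarrow> bool" where
  "order_ge k f \<longleftrightarrow> (\<forall>m\<in>Poly_Mapping.keys f. k \<le> mon_weight m)"

lemma order_ge_mult:
  assumes "order_ge k f" "order_ge l g"
  shows "order_ge (k + l) (f * g)"
  using assms keys_mult[of f g] unfolding order_ge_def
  by (fastforce simp: mon_weight_add intro: add_mono)

lemma order_ge_0 [simp]: "order_ge 0 f"
  by (simp add: order_ge_def)

lemma order_ge_sum:
  assumes "\<And>i. i \<in> S \<Longrightarrow> order_ge k (f i)"
  shows "order_ge k (sum f S)"
  using assms
proof (induction S rule: infinite_finite_induct)
  case (insert x F)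
  then show ?case
    using Poly_Mapping.keys_add[of "f x" "sum f F"] by (auto simp: order_ge_def)
qed (auto simp: order_ge_def)

lemma order_ge_power_sum: "order_ge (Suc i) (power_sum (Suc i))"
  by (simp add: order_ge_def power_sum_def mon_weight_def)

text \<open>Every monomial of \<open>f * v\<close> has degree at least \<open>k\<close>; beyond the
  degrees occurring in \<open>x\<close> it pairs to 0 with \<open>x\<close>. The bound depends on
  \<open>x\<close> alone.\<close>

lemma perp_eq_0_if_order_ge:
  "\<exists>K. \<forall>k>K. \<forall>f. order_ge k f \<longrightarrow> perp f x = 0"
proof (induction x rule: symfun_induct)
  case (single b d)
  have "perp f (Poly_Mapping.single b d) = 0" if "k > mon_weight b" "order_ge k f" for k f
  proof (rule perp_unique)
    fix v
    have "order_ge k (f * v)" using order_ge_mult[OF that(2) order_ge_0] by simp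
    then have "Poly_Mapping.lookup (f * v) b = 0"
      using that(1) by (force simp: order_ge_def in_keys_iff)
    then show "sym_inner 0 v = sym_inner (Poly_Mapping.single b d) (f * v)"
      by (simp add: sym_inner_single_left) (simp add: sym_inner_def)
  qed
  then show ?case by blast
next
  case (add x y)
  then obtain K L where "\<And>k f. k > K \<Longrightarrow> order_ge k f \<Longrightarrow> perp f x = 0"
    "\<And>k f. k > L \<Longrightarrow> order_ge k f \<Longrightarrow> perp f y = 0" by blast
  then have "\<forall>k>max K L. \<forall>f. order_ge k f \<longrightarrow> perp f (x + y) = 0"
    by (auto simp: perp_add)
  then show ?case by blast
qed simp

section \<open>Complete and elementary functions in one family\<close>

text \<open>For a sign \<open>s\<close> this is the coefficient of \<open>u\<^sup>n\<close> in \<open>exp (s \<Sum> p\<^sub>k u\<^sup>k / k)\<close>, that is, in \<open>H(u)\<close>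
  for \<open>s = 1\<close> and in \<open>E(-u)\<close> for \<open>s = -1\<close>; so the two cases of Newton's identities become one.\<close>

definition qsym :: "symfun \<Rightarrow> int \<Rightarrow> symfun" where
  "qsym s n = (if n < 0 then 0 else if s = 1 then complete_sym (nat n)
    else (- 1) ^ nat n * elementary_sym (nat n))"

lemma qsym_neg [simp]: "n < 0 \<Longrightarrow> qsym s n = 0"
  by (simp add: qsym_def)

lemma qsym_0 [simp]: "qsym s 0 = 1"
  by (simp add: qsym_def)

lemma sym_const_inverse_of_nat: "of_nat (Suc n) * sym_const (1 / of_nat (Suc n)) = 1"
proof -
  have "of_nat (Suc n) * sym_const (1 / of_nat (Suc n)) =
      sym_const (of_nat (Suc n) * (1 / of_nat (Suc n)))"
    unfolding sym_const_mult sym_const_of_nat ..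
  then show ?thesis by (simp add: sym_const_one del: of_nat_Suc)
qed

lemma one_neq_minus_one: "(1::symfun) \<noteq> - 1"
  by (metis one_neq_neg_one)

lemma qsym_Suc:
  assumes "s = 1 \<or> s = - 1"
  shows "of_nat (Suc n) * qsym s (int (Suc n)) =
    s * (\<Sum>i\<le>n. power_sum (Suc i) * qsym s (int n - int i))"
proof (cases "s = 1")
  case True
  have *: "(\<Sum>i\<le>n. power_sum (Suc i) * complete_sym (n - i)) =
      (\<Sum>i\<le>n. power_sum (Suc i) * qsym s (int n - int i))"
    by (rule sum.cong) (auto simp: qsym_def True nat_diff_distrib)
  show ?thesis
    unfolding *[symmetric]
    by (simp add: qsym_def True mult.assoc[symmetric] sym_const_inverse_of_nat
        del: of_nat_Suc power_Suc)
next
  case False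
  then have s: "s = - 1" using assms by simp
  have "(- 1) ^ Suc n * (\<Sum>i\<le>n. (- 1) ^ i * power_sum (Suc i) * elementary_sym (n - i)) =
      s * (\<Sum>i\<le>n. power_sum (Suc i) * qsym s (int n - int i))"
    unfolding sum_distrib_left
  proof (rule sum.cong)
    fix i assume "i \<in> {..n}"
    then obtain j where n: "n = i + j" by (auto simp: le_iff_add)
    \<comment> \<open>The signs of \<open>qsym\<close> and of Newton's identity combine to
      \<open>- ((- 1) ^ j)\<close>: the power belongs to the smaller \<open>qsym\<close>, and the
      remaining minus is \<open>s\<close>.\<close>
    have "(- 1) ^ i * (- 1) ^ i = (1 :: symfun)"
      by (simp add: power_add[symmetric])
    then show "(- 1) ^ Suc n * ((- 1) ^ i * power_sum (Suc i) * elementary_sym (n - i)) =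
        s * (power_sum (Suc i) * qsym s (int n - int i))"
      by (simp add: n qsym_def s False one_neq_minus_one[symmetric] power_add algebra_simps)
  qed simp
  moreover have "of_nat (Suc n) * qsym s (int (Suc n)) = (- 1) ^ Suc n *
      (of_nat (Suc n) * sym_const (1 / of_nat (Suc n)) *
       (\<Sum>i\<le>n. (- 1) ^ i * power_sum (Suc i) * elementary_sym (n - i)))"
    by (simp add: qsym_def False ac_simps del: of_nat_Suc power_Suc)
  ultimately show ?thesis by (simp add: sym_const_inverse_of_nat del: of_nat_Suc power_Suc)
qed

text \<open>Newton's recurrence, with the factor \<open>n\<close> divided out, propagates the degree
  bound.\<close>

lemma order_ge_qsym: 
  assumes "s = 1 \<or> s = - 1"
  shows "order_ge n (qsym s (int n))"
proof (induction n rule: less_induct)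
  case (less n)
  show ?case
  proof (cases n)
    case (Suc m)
    have "order_ge n (power_sum (Suc i) * qsym s (int m - int i))" if "i \<le> m" for i
      using order_ge_mult[OF order_ge_power_sum[of i] less[of "m - i"]] that
      by (simp add: Suc of_nat_diff)
    then have "order_ge n (\<Sum>i\<le>m. power_sum (Suc i) * qsym s (int m - int i))"
      by (intro order_ge_sum) auto
    then have "order_ge (0 + n) ((sym_const (1 / of_nat (Suc m)) * s) * (\<Sum>i\<le>m. power_sum (Suc i)
      * qsym s (int m - int i)))"
      by (intro order_ge_mult) auto
    also have "(sym_const (1 / of_nat (Suc m)) * s) * (\<Sum>i\<le>m. power_sum (Suc i)
      * qsym s (int m - int i))
       = (of_nat (Suc m) * sym_const (1 / of_nat (Suc m))) * qsym s (int n)"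
      using qsym_Suc[OF assms, of m] by (simp add: Suc ac_simps del: of_nat_Suc)
    finally show ?thesis by (simp add: sym_const_inverse_of_nat del: of_nat_Suc)
  qed simp
qed

text \<open>The coefficients of \<open>u Q'(u) = s P(u) Q(u)\<close>, where \<open>P(u)\<close> is
  the sum of the \<open>p_k u^k\<close>. For \<open>n \<le> 0\<close> both sides vanish.\<close>

lemma qsym_recurrence:
  assumes "s = 1 \<or> s = - 1"
  shows "of_int n * qsym s n = s * (\<Sum>i<nat n. power_sum (Suc i) * qsym s (n - 1 - int i))"
proof (cases "nat n")
  case 0
  then show ?thesis by (cases "n = 0") auto
next
  case (Suc m)
  then have n: "n = int (Suc m)" by simp
  show ?thesis
    using qsym_Suc[OF assms, of m] unfolding n nat_int lessThan_Suc_atMost by simp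
qed

text \<open>Applying \<open>k d/dp_k\<close> to the exponential series multiplies it by
  \<open>s u^k\<close>. In coefficients this becomes an induction along Newton's recurrence.\<close>

lemma perp_power_sum_qsym:
  assumes s: "s = 1 \<or> s = - 1"
  shows "perp (power_sum (Suc i)) (qsym s n) = s * qsym s (n - int (Suc i))"
proof (induction n rule: measure_induct_rule[of nat])
  case (less n)
  let ?P = "perp (power_sum (Suc i))"
  consider "n < 0" | "n = 0" | "n > 0" by linarith
  then show ?case
  proof cases
    case 2
    \<comment> \<open>A derivation kills \<open>1\<close>, because \<open>1 * 1 = 1\<close>.\<close>
    have "perp (power_sum (Suc i)) (1 * 1) = ?P 1 + ?P 1"
      using perp_power_sum_mult[of i 1 1] by simp
    then show ?thesis using 2 by simp
  next
    case 3
    have scale: "?P (s * x) = s * ?P x" for x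
      using s by (auto simp: perp_minus)
    have ofi: "?P (of_int n * x) = of_int n * ?P x" for x
    proof -
      have "of_int n = sym_const (of_nat (nat n))"
        unfolding sym_const_of_nat using 3 by simp
      then show ?thesis by (simp add: perp_scale)
    qed
    have "of_int n * ?P (qsym s n) = s * (\<Sum>j<nat n. ?P (power_sum (Suc j)
      * qsym s (n - 1 - int j)))"
      unfolding ofi[symmetric] qsym_recurrence[OF s] scale perp_sum ..
    also have "(\<Sum>j<nat n. ?P (power_sum (Suc j) * qsym s (n - 1 - int j))) =
        (\<Sum>j<nat n. (if j = i then of_nat (Suc i) * qsym s (n - 1 - int j) else 0)
          + power_sum (Suc j) * (s * qsym s (n - 1 - int j - int (Suc i))))"
    proof (rule sum.cong[OF refl], goal_cases)
      case (1 j)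
      then have "nat (n - 1 - int j) < nat n" by auto
      from less.IH[OF this] show ?case
        by (auto simp: perp_power_sum_mult perp_power_sum_power_sum)
    qed
    also have "\<dots> = of_nat (Suc i) * qsym s (n - int (Suc i)) +
       (\<Sum>j<nat n. power_sum (Suc j) * (s * qsym s (n - 1 - int j - int (Suc i))))"
      using 3 by (auto simp: sum.distrib algebra_simps nat_less_iff)
    also have "(\<Sum>j<nat n. power_sum (Suc j) * (s * qsym s (n - 1 - int j - int (Suc i)))) =
        (\<Sum>j<nat (n - int (Suc i)). power_sum (Suc j) * (s * qsym s (n - int (Suc i) - 1 - int j)))"
      by (rule sum.mono_neutral_cong_right) (auto simp: algebra_simps)
    also have "\<dots> = s * (\<Sum>j<nat (n - int (Suc i)). power_sum (Suc j)
      * qsym s (n - int (Suc i) - 1 - int j))"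
      by (simp add: sum_distrib_left algebra_simps)
    also have "\<dots> = of_int (n - int (Suc i)) * qsym s (n - int (Suc i))"
      by (rule qsym_recurrence[OF s, symmetric])
    \<comment> \<open>The coefficients \<open>Suc i\<close> and \<open>n - Suc i\<close> add up to
      \<open>n\<close>, which cancels since \<open>n > 0\<close>.\<close>
    also have "s * (of_nat (Suc i) * qsym s (n - int (Suc i)) + of_int (n - int (Suc i))
      * qsym s (n - int (Suc i)))
       = of_int n * (s * qsym s (n - int (Suc i)))"
      by (simp add: algebra_simps)
    finally show ?thesis using 3 by simp
  qed simp
qed

lemma perp_of_int_left: "perp (of_int n * f) x = of_int n * perp f x"
  by (cases n rule: int_cases2) (simp_all add: perp_of_nat_left perp_minus_left)

lemma perp_sign_left: "s = 1 \<or> s = - 1 \<Longrightarrow> perp (s * f) x = s * perp f x"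
  by (auto simp: perp_minus_left)

text \<open>Newton's recurrence carried over by \<open>perp_mult\<close>. It drives the inductions
  on the adjoint index in the two commutation lemmas below.\<close>

lemma perp_qsym_recurrence:
  assumes "s = 1 \<or> s = - 1"
  shows "of_int n * perp (qsym s n) x =
    s * (\<Sum>i<nat n. perp (power_sum (Suc i)) (perp (qsym s (n - 1 - int i)) x))"
  unfolding perp_of_int_left[symmetric] qsym_recurrence[OF assms]
    perp_sign_left[OF assms] perp_sum_left
  unfolding perp_mult ..

lemma sum_telescope_int:
  fixes f :: "int \<Rightarrow> 'a::ab_group_add"
  shows "(\<Sum>i<k. f (a - int i) - f (a - int i - 1)) = f a - f (a - int k)"
  by (induction k) (auto simp: algebra_simps)

section \<open>Commutation of adjoints and multiplication operators\<close>

text \<open>Writing \<open>Q\<^sub>t(v)\<close> for the series of the \<open>qsym t j\<close> and \<open>Q\<^sub>s\<^sup>\<bottom>(u)\<close> for that of the adjoints,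
  this
  is \<open>Q\<^sub>s\<^sup>\<bottom>(u) Q\<^sub>t(v) = (1 - v/u) Q\<^sub>t(v) Q\<^sub>s\<^sup>\<bottom>(u)\<close> for \<open>t = -s\<close>.\<close>

lemma perp_qsym_mult_opposite:
  assumes s: "s = 1 \<or> s = - 1" and t: "t = - s"
  shows "perp (qsym s k) (qsym t j * x) =
    qsym t j * perp (qsym s k) x - qsym t (j - 1) * perp (qsym s (k - 1)) x"
proof (induction k rule: measure_induct_rule[of nat])
  case (less k)
  let ?D = "\<lambda>k. perp (qsym s k) x" and ?q = "qsym t" and ?p = "\<lambda>i. perp (power_sum (Suc i))"
  consider "k < 0" | "k = 0" | "k > 0" by linarith
  then show ?case
  proof cases
    case 3
    have t': "t = 1 \<or> t = - 1" using s t by auto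
    have "of_int k * perp (qsym s k) (?q j * x) = s
      * (\<Sum>i<nat k. ?p i (perp (qsym s (k - 1 - int i)) (?q j * x)))"
      by (rule perp_qsym_recurrence[OF s])
    \<comment> \<open>Induction hypothesis, then Leibniz: differentiating the \<open>qsym t\<close>
      factors gives the difference in parentheses, differentiating the rest gives the other two
      terms.\<close>
    also have "(\<Sum>i<nat k. ?p i (perp (qsym s (k - 1 - int i)) (?q j * x))) =
      (\<Sum>i<nat k. t * (?q (j - 1 - int i) * ?D (k - 1 - int i)
          - ?q (j - 1 - int i - 1) * ?D (k - 1 - int i - 1))
        + ?q j * ?p i (?D (k - 1 - int i)) - ?q (j - 1) * ?p i (?D (k - 1 - 1 - int i)))"
    proof (rule sum.cong[OF refl], goal_cases)
      case (1 i)
      then have "nat (k - 1 - int i) < nat k" by auto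
      note IH = less.IH[OF this]
      show ?case unfolding IH
        by (simp add: perp_diff perp_power_sum_mult perp_power_sum_qsym[OF t'] algebra_simps)
    qed
    also have "\<dots> = t * (\<Sum>i<nat k. ?q (j - 1 - int i) * ?D (k - 1 - int i)
          - ?q (j - 1 - int i - 1) * ?D (k - 1 - int i - 1))
        + ?q j * (\<Sum>i<nat k. ?p i (?D (k - 1 - int i)))
        - ?q (j - 1) * (\<Sum>i<nat k. ?p i (?D (k - 1 - 1 - int i)))"
      by (simp add: sum.distrib sum_subtractf sum_distrib_left right_diff_distrib)
    also have "(\<Sum>i<nat k. ?p i (?D (k - 1 - 1 - int i)))
      = (\<Sum>i<nat (k - 1). ?p i (?D (k - 1 - 1 - int i)))"
      by (rule sum.mono_neutral_right) auto
    \<comment> \<open>Both indices drop together, so the sum telescopes; its lower end has adjoint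
      index -1 and vanishes.\<close>
    also have "(\<Sum>i<nat k. ?q (j - 1 - int i) * ?D (k - 1 - int i)
          - ?q (j - 1 - int i - 1) * ?D (k - 1 - int i - 1)) = ?q (j - 1) * ?D (k - 1)"
      using sum_telescope_int[of "\<lambda>i. ?q (j - k + i) * ?D i" "k - 1" "nat k"] 3
      by (simp add: algebra_simps)
    \<comment> \<open>Since \<open>s * t = - 1\<close>, the boundary term raises the factor
      \<open>k - 1\<close>, supplied by the recurrence at \<open>k - 1\<close>, to
      \<open>k\<close>.\<close>
    also have "s * (t * (?q (j - 1) * ?D (k - 1)) + ?q j * (\<Sum>i<nat k. ?p i (?D (k - 1 - int i)))
        - ?q (j - 1) * (\<Sum>i<nat (k - 1). ?p i (?D (k - 1 - 1 - int i)))) =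
      ?q j * (s * (\<Sum>i<nat k. ?p i (?D (k - 1 - int i))))
        - ?q (j - 1) * (s * (\<Sum>i<nat (k - 1). ?p i (?D (k - 1 - 1 - int i))))
        - ?q (j - 1) * ?D (k - 1)"
      using s t by (auto simp: algebra_simps)
    also have "\<dots> = of_int k * (?q j * ?D k - ?q (j - 1) * ?D (k - 1))"
      unfolding perp_qsym_recurrence[OF s, symmetric] by (simp add: algebra_simps)
    finally have "of_int k * perp (qsym s k) (?q j * x) =
       of_int k * (?q j * ?D k - ?q (j - 1) * ?D (k - 1))" .
    then show ?thesis using 3 by simp
  qed auto
qed

text \<open>Likewise \<open>(1 - v/u) Q\<^sub>s\<^sup>\<bottom>(u) Q\<^sub>s(v) = Q\<^sub>s(v) Q\<^sub>s\<^sup>\<bottom>(u)\<close>; multiplying by \<open>1 - v/u\<close> avoids the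
  geometric series.\<close>

lemma perp_qsym_mult_same:
  assumes s: "s = 1 \<or> s = - 1"
  shows "perp (qsym s k) (qsym s j * x) =
    qsym s j * perp (qsym s k) x + perp (qsym s (k - 1)) (qsym s (j - 1) * x)"
\<comment> \<open>The hypothesis is used at \<open>j\<close> and at
  \<open>j - 1 - int i\<close>.\<close>
proof (induction k arbitrary: j rule: measure_induct_rule[of nat])
  case (less k)
  let ?D = "\<lambda>k. perp (qsym s k) x" and ?q = "qsym s" and ?p = "\<lambda>i. perp (power_sum (Suc i))"
  let ?T = "\<lambda>k j. perp (qsym s k) (qsym s j * x)"
  consider "k < 0" | "k = 0" | "k > 0" by linarith
  then show ?case
  proof cases
    case 3
    have "of_int k * ?T k j = s * (\<Sum>i<nat k. ?p i (?T (k - 1 - int i) j))"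
      by (rule perp_qsym_recurrence[OF s])
    also have "(\<Sum>i<nat k. ?p i (?T (k - 1 - int i) j)) =
      (\<Sum>i<nat k. s * (?T (k - 1 - int i) (j - 1 - int i) - ?T (k - 1 - int i - 1) (j - 1 - int i -
        1))
        + ?q j * ?p i (?D (k - 1 - int i)) + ?p i (?T (k - 1 - 1 - int i) (j - 1)))"
    proof (rule sum.cong[OF refl], goal_cases)
      case (1 i)
      then have "nat (k - 1 - int i) < nat k" by auto
      note IH = less.IH[OF this]
      \<comment> \<open>The hypothesis read backwards turns the differentiated term into a
        difference along the diagonal, so that it telescopes.\<close>
      have e: "?T (k - 1 - int i) (j - 1 - int i) - ?T (k - 1 - int i - 1) (j - 1 - int i - 1)
          = ?q (j - 1 - int i) * ?D (k - 1 - int i)"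
        using IH[of "j - 1 - int i"] by simp
      show ?case unfolding e using IH[of j]
        by (simp add: perp_add perp_power_sum_mult perp_power_sum_qsym[OF s] algebra_simps)
    qed
    also have "\<dots> = s * (\<Sum>i<nat k. ?T (k - 1 - int i) (j - 1 - int i) - ?T (k - 1 - int i - 1) (j -
      1 - int i - 1))
        + ?q j * (\<Sum>i<nat k. ?p i (?D (k - 1 - int i)))
        + (\<Sum>i<nat k. ?p i (?T (k - 1 - 1 - int i) (j - 1)))"
      by (simp add: sum.distrib sum_distrib_left)
    also have "(\<Sum>i<nat k. ?p i (?T (k - 1 - 1 - int i) (j - 1)))
      = (\<Sum>i<nat (k - 1). ?p i (?T (k - 1 - 1 - int i) (j - 1)))"
      by (rule sum.mono_neutral_right) auto
    also have "(\<Sum>i<nat k. ?T (k - 1 - int i) (j - 1 - int i) - ?T (k - 1 - int i - 1) (j - 1 - int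
      i - 1)) = ?T (k - 1) (j - 1)"
      using sum_telescope_int[of "\<lambda>i. ?T i (j - k + i)" "k - 1" "nat k"] 3
      by (simp add: algebra_simps)
    also have "s * (s * ?T (k - 1) (j - 1) + ?q j * (\<Sum>i<nat k. ?p i (?D (k - 1 - int i)))
        + (\<Sum>i<nat (k - 1). ?p i (?T (k - 1 - 1 - int i) (j - 1)))) =
      ?q j * (s * (\<Sum>i<nat k. ?p i (?D (k - 1 - int i))))
        + s * (\<Sum>i<nat (k - 1). ?p i (?T (k - 1 - 1 - int i) (j - 1)))
        + ?T (k - 1) (j - 1)"
      using s by (auto simp: algebra_simps)
    also have "\<dots> = of_int k * (?q j * ?D k + ?T (k - 1) (j - 1))"
      unfolding perp_qsym_recurrence[OF s, symmetric] by (simp add: algebra_simps)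
    finally have "of_int k * ?T k j = of_int k * (?q j * ?D k + ?T (k - 1) (j - 1))" .
    then show ?thesis using 3 by simp
  qed auto
qed

text \<open>This is \<open>H(u) E(-u) = 1\<close>: by Newton the logarithmic derivatives of the two
  factors are opposite, so \<open>n\<close> times the \<open>n\<close>-th coefficient of the product
  is 0.\<close>

lemma qsym_convolution:
  assumes s: "s = 1 \<or> s = - 1"
  shows "(\<Sum>i\<in>{0..n}. qsym s i * qsym (- s) (n - i)) = (if n = 0 then 1 else 0)"
proof -
  consider "n < 0" | "n = 0" | "n > 0" by linarith
  then show ?thesis
  proof cases
    case 3
    let ?c = "\<lambda>s m. \<Sum>i\<in>{0..m::int}. qsym s i * qsym (- s) (m - i)"
    have key: "(\<Sum>i\<in>{0..n}. of_int i * qsym s i * qsym (- s) (n - i)) =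
      s * (\<Sum>j<nat n. power_sum (Suc j) * ?c s (n - 1 - int j))" if s: "s = 1 \<or> s = - 1" for s
    proof -
      have "(\<Sum>i\<in>{0..n}. of_int i * qsym s i * qsym (- s) (n - i)) =
        (\<Sum>i\<in>{0..n}. \<Sum>j<nat n. s * (power_sum (Suc j) * (qsym s (i - 1 - int j)
          * qsym (- s) (n - i))))"
      proof (rule sum.cong[OF refl], goal_cases)
        case (1 i)
        have "(\<Sum>j<nat i. power_sum (Suc j) * qsym s (i - 1 - int j)) =
           (\<Sum>j<nat n. power_sum (Suc j) * qsym s (i - 1 - int j))"
          by (rule sum.mono_neutral_left) (use 1 in auto)
        then show ?case unfolding qsym_recurrence[OF s]
          by (simp add: sum_distrib_left sum_distrib_right mult.assoc)
      qed
      also have "\<dots> = (\<Sum>j<nat n. \<Sum>i\<in>{0..n}. s * (power_sum (Suc j) * (qsym s (i - 1 - int j)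
        * qsym (- s) (n - i))))"
        by (rule sum.swap)
      also have "\<dots> = (\<Sum>j<nat n. s * (power_sum (Suc j) * ?c s (n - 1 - int j)))"
      proof (rule sum.cong[OF refl], goal_cases)
        case (1 j)
        have "(\<Sum>i\<in>{0..n}. qsym s (i - 1 - int j) * qsym (- s) (n - i)) =
          (\<Sum>i\<in>{1 + int j..n}. qsym s (i - 1 - int j) * qsym (- s) (n - i))"
          by (rule sum.mono_neutral_right) auto
        also have "\<dots> = ?c s (n - 1 - int j)"
          by (rule sum.reindex_bij_witness[of _ "\<lambda>i. i + (1 + int j)" "\<lambda>i. i - (1 + int j)"])
            (auto simp: algebra_simps)
        finally show ?case by (simp add: sum_distrib_left[symmetric])
      qed
      finally show ?thesis by (simp add: sum_distrib_left)
    qed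
    \<comment> \<open>Reversing the sum exchanges the signs, so both halves of
      \<open>n = i + (n - i)\<close> lead to the same convolutions, with opposite
      prefactors.\<close>
    have sym: "?c (- s) m = ?c s m" for m
      by (rule sum.reindex_bij_witness[of _ "\<lambda>i. m - i" "\<lambda>i. m - i"]) (auto simp: mult.commute)
    have "of_int n * ?c s n = (\<Sum>i\<in>{0..n}. of_int i * qsym s i * qsym (- s) (n - i))
       + (\<Sum>i\<in>{0..n}. of_int (n - i) * qsym s i * qsym (- s) (n - i))"
      by (simp add: sum_distrib_left sum.distrib[symmetric] algebra_simps)
    also have "(\<Sum>i\<in>{0..n}. of_int (n - i) * qsym s i * qsym (- s) (n - i)) =
       (\<Sum>i\<in>{0..n}. of_int i * qsym (- s) i * qsym (- (- s)) (n - i))"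
      by (rule sum.reindex_bij_witness[of _ "\<lambda>i. n - i" "\<lambda>i. n - i"]) auto
    also have "\<dots> = - s * (\<Sum>j<nat n. power_sum (Suc j) * ?c (- s) (n - 1 - int j))"
      using s by (intro key) auto
    also have "(\<Sum>i\<in>{0..n}. of_int i * qsym s i * qsym (- s) (n - i)) =
        s * (\<Sum>j<nat n. power_sum (Suc j) * ?c s (n - 1 - int j))"
      by (rule key[OF s])
    finally have "of_int n * ?c s n = of_int n * 0"
      unfolding sym by simp
    then show ?thesis using 3 by simp
  qed auto
qed

lemma perp_qsym_eventually_0:
  "\<exists>K. \<forall>k>K. \<forall>s. (s = 1 \<or> s = - 1) \<longrightarrow> perp (qsym s k) x = 0"
proof -
  obtain K where K: "\<And>k f. k > K \<Longrightarrow> order_ge k f \<Longrightarrow> perp f x = 0"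
    using perp_eq_0_if_order_ge by blast
  have "perp (qsym s k) x = 0" if "k > int K" "s = 1 \<or> s = - 1" for s k
    using K[of "nat k" "qsym s k"] order_ge_qsym[OF that(2), of "nat k"] that(1) by auto
  then show ?thesis by blast
qed

section \<open>Vertex operators on symmetric functions\<close>

text \<open>One cutoff for both signs, so that the same \<open>K\<close> truncates the sums of
  either charge.\<close>

definition perp_bound :: "int \<Rightarrow> symfun \<Rightarrow> bool" where
  "perp_bound K x \<longleftrightarrow> (\<forall>k>K. \<forall>s. (s = 1 \<or> s = - 1) \<longrightarrow> perp (qsym s k) x = 0)"

lemma perp_bound_exists: "\<exists>K\<ge>L. perp_bound K x"
proof -
  obtain K where "perp_bound K x"
    using perp_qsym_eventually_0 unfolding perp_bound_def by blast
  then have "perp_bound (max K L) x" by (auto simp: perp_bound_def)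
  then show ?thesis by (intro exI[of _ "max K L"]) auto
qed

lemma perp_bound_mono: "perp_bound K x \<Longrightarrow> K \<le> L \<Longrightarrow> perp_bound L x"
  by (auto simp: perp_bound_def)

lemma perp_boundD: "perp_bound K x \<Longrightarrow> k > K \<Longrightarrow> s = 1 \<or> s = - 1 \<Longrightarrow> perp (qsym s k) x = 0"
  by (auto simp: perp_bound_def)

text \<open>The coefficient of \<open>u^n\<close> in \<open>Q_t(u)\<close> times the adjoint series
  of sign \<open>- t\<close>, applied to \<open>x\<close>; the sign \<open>t\<close> is the
  charge.\<close>

definition vertex :: "symfun \<Rightarrow> int \<Rightarrow> symfun \<Rightarrow> symfun" where
  "vertex t n x = Sum_any (\<lambda>k. qsym t (n + k) * perp (qsym (- t) k) x)"

text \<open>Negative \<open>k\<close> contribute 0. The free lower end \<open>L\<close> accommodates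
  sums that start at -1 after an index shift.\<close>

lemma vertex_eq_sum:
  assumes "perp_bound K x" "t = 1 \<or> t = - 1" "L \<le> 0"
  shows "vertex t n x = (\<Sum>k\<in>{L..K}. qsym t (n + k) * perp (qsym (- t) k) x)"
  unfolding vertex_def
proof (rule Sum_any.expand_superset)
  show "{k. qsym t (n + k) * perp (qsym (- t) k) x \<noteq> 0} \<subseteq> {L..K}"
  proof
    fix k assume k: "k \<in> {k. qsym t (n + k) * perp (qsym (- t) k) x \<noteq> 0}"
    have "\<not> k < 0" using k by auto
    moreover have "\<not> k > K"
    proof
      assume "k > K"
      then have "perp (qsym (- t) k) x = 0"
        by (rule perp_boundD[OF assms(1)]) (use assms(2) in auto)
      then show False using k by simp
    qed
    ultimately show "k \<in> {L..K}" using assms(3) by auto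
  qed
qed simp

lemma vertex_add:
  assumes t: "t = 1 \<or> t = - 1"
  shows "vertex t n (x + y) = vertex t n x + vertex t n y"
proof -
  obtain K where K: "perp_bound K x" using perp_bound_exists by blast
  obtain L where L: "L \<ge> K" "perp_bound L y" using perp_bound_exists by blast
  have x: "perp_bound L x" using perp_bound_mono[OF K L(1)] .
  have xy: "perp_bound L (x + y)"
    using x L(2) by (simp add: perp_bound_def perp_add)
  show ?thesis
    unfolding vertex_eq_sum[OF xy t order_refl] vertex_eq_sum[OF x t order_refl]
      vertex_eq_sum[OF L(2) t order_refl]
    by (simp add: perp_add distrib_left sum.distrib)
qed

lemma vertex_zero [simp]: "vertex t n 0 = 0"
  by (simp add: vertex_def)

lemma vertex_scale:
  assumes t: "t = 1 \<or> t = - 1"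
  shows "vertex t n (sym_const c * x) = sym_const c * vertex t n x"
proof -
  obtain K where x: "perp_bound K x" using perp_bound_exists by blast
  have cx: "perp_bound K (sym_const c * x)"
    using x by (simp add: perp_bound_def perp_scale)
  show ?thesis
    unfolding vertex_eq_sum[OF x t order_refl] vertex_eq_sum[OF cx t order_refl]
    by (simp add: perp_scale sum_distrib_left mult.left_commute)
qed

text \<open>For all \<open>k \<le> K\<close> the index \<open>n + k\<close> of the multiplication
  factor is negative.\<close>

lemma vertex_eq_0:
  assumes "perp_bound K x" "t = 1 \<or> t = - 1" "n < - K"
  shows "vertex t n x = 0"
  unfolding vertex_eq_sum[OF assms(1,2) order_refl] by (rule sum.neutral) (use assms(3) in auto)

section \<open>Agreement of \<open>vertex\<close> with the coefficients defining the
  fermions\<close>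

lemma Sum_any_antidiagonal:
  fixes g :: "nat \<Rightarrow> nat \<Rightarrow> symfun"
  assumes "\<And>j k. int k > K \<Longrightarrow> g j k = 0"
  shows "Sum_any (\<lambda>(j, k). if int j - int k = n then g j k else 0) =
    (\<Sum>k\<in>{0..K}. if n + k < 0 then 0 else g (nat (n + k)) (nat k))"
proof -
  let ?I = "{k \<in> {0..K}. 0 \<le> n + k}"
  let ?w = "\<lambda>k. (nat (n + k), nat k)"
  have "Sum_any (\<lambda>(j, k). if int j - int k = n then g j k else 0) =
    (\<Sum>(j, k)\<in>?w ` ?I. if int j - int k = n then g j k else 0)"
  proof (rule Sum_any.expand_superset)
    show "{p. (case p of (j, k) \<Rightarrow> if int j - int k = n then g j k else 0) \<noteq> 0} \<subseteq> ?w ` ?I"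
    proof
      fix p assume p: "p \<in> {p. (case p of (j, k) \<Rightarrow> if int j - int k = n then g j k else 0) \<noteq> 0}"
      obtain j k where jk: "p = (j, k)" by (cases p)
      have "g j k \<noteq> 0" and n: "n = int j - int k" using p jk by (auto split: if_splits)
      then have "int k \<le> K" using assms not_le by blast
      then show "p \<in> ?w ` ?I"
        unfolding jk by (intro image_eqI[of _ _ "int k"]) (auto simp: n)
    qed
    show "finite (?w ` ?I)" by (intro finite_imageI finite_subset[of ?I "{0..K}"]) auto
  qed
  also have "\<dots> = (\<Sum>k\<in>?I. g (nat (n + k)) (nat k))"
    by (subst sum.reindex) (auto simp: inj_on_def intro!: sum.cong)
  also have "\<dots> = (\<Sum>k\<in>{0..K}. if n + k < 0 then 0 else g (nat (n + k)) (nat k))"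
    by (rule sum.mono_neutral_cong_left) auto
  finally show ?thesis .
qed

lemma qsym_complete: "n \<ge> 0 \<Longrightarrow> qsym 1 n = complete_sym (nat n)"
  and qsym_elementary: "n \<ge> 0 \<Longrightarrow> qsym (- 1) n = (- 1) ^ nat n * elementary_sym (nat n)"
  using one_neq_minus_one by (auto simp: qsym_def)

lemma perp_elementary: "(- 1) ^ k * perp (elementary_sym k) x = perp (qsym (- 1) (int k)) x"
proof -
  have "perp ((- 1) ^ k * f) x = (- 1) ^ k * perp f x" for f
    by (cases "even k") (auto simp: perp_minus_left)
  then show ?thesis by (simp add: qsym_elementary)
qed

lemma HE_coeff_eq_vertex: "HE_coeff n x = vertex 1 n x"
proof -
  obtain K where K: "perp_bound K x" using perp_bound_exists by blast
  have "HE_coeff n x = (\<Sum>k\<in>{0..K}. if n + k < 0 then 0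
      else complete_sym (nat (n + k)) * ((- 1) ^ nat k * perp (elementary_sym (nat k)) x))"
    unfolding HE_coeff_def
    by (rule Sum_any_antidiagonal) (auto simp: perp_elementary perp_boundD[OF K])
  also have "\<dots> = vertex 1 n x"
    unfolding vertex_eq_sum[OF K disjI1[OF refl] order_refl]
    by (rule sum.cong) (auto simp: qsym_complete perp_elementary)
  finally show ?thesis .
qed

lemma EH_coeff_eq_vertex: "EH_coeff n x = vertex (- 1) n x"
proof -
  obtain K where K: "perp_bound K x" using perp_bound_exists by blast
  have "EH_coeff n x = (\<Sum>k\<in>{0..K}. if n + k < 0 then 0
      else (- 1) ^ nat (n + k) * elementary_sym (nat (n + k)) * perp (complete_sym (nat k)) x)"
    unfolding EH_coeff_def
    by (rule Sum_any_antidiagonal)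
      (use perp_boundD[OF K] in \<open>auto simp: qsym_complete[of "int _", simplified, symmetric]\<close>)
  also have "\<dots> = vertex (- 1) n x"
    unfolding vertex_eq_sum[OF K disjI2[OF refl] order_refl]
    by (rule sum.cong) (auto simp: qsym_complete qsym_elementary)
  finally show ?thesis .
qed

text \<open>The coefficient of \<open>u\<^sup>a v\<^sup>b\<close> in \<open>Q\<^sub>t(u) Q\<^bsub>t'\<^esub>(v) Q\<^bsub>-t\<^esub>\<^sup>\<bottom>(u) Q\<^bsub>-t'\<^esub>\<^sup>\<bottom>(v) x\<close>, provided that
  \<open>K\<close> is
  a \<open>perp_bound\<close> for \<open>x\<close>.\<close>

definition normal_ordered ::
  "symfun \<Rightarrow> symfun \<Rightarrow> int \<Rightarrow> int \<Rightarrow> int \<Rightarrow> symfun \<Rightarrow> symfun" where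
  "normal_ordered t t' K a b x = (\<Sum>k\<in>{0..K}. \<Sum>l\<in>{0..K}.
     qsym t (a + k) * (qsym t' (b + l) * perp (qsym (- t) k) (perp (qsym (- t') l) x)))"

text \<open>Multiplications commute with each other, and so do adjoints.\<close>

lemma normal_ordered_swap: "normal_ordered t t' K a b x = normal_ordered t' t K b a x"
  unfolding normal_ordered_def
  by (subst sum.swap) (simp add: perp_commute[of "qsym (- t) _"] mult.left_commute)

lemma normal_ordered_eq_sum:
  assumes x: "perp_bound K x" and t: "t = 1 \<or> t = - 1" and S: "L \<le> 0" "M \<ge> K"
  shows "normal_ordered t t' K a b x = (\<Sum>k\<in>{L..M}. \<Sum>l\<in>{0..K}.
     qsym t (a + k) * (qsym t' (b + l) * perp (qsym (- t) k) (perp (qsym (- t') l) x)))"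
  unfolding normal_ordered_def
proof (rule sum.mono_neutral_left)
  show "\<forall>k\<in>{L..M} - {0..K}. (\<Sum>l\<in>{0..K}.
     qsym t (a + k) * (qsym t' (b + l) * perp (qsym (- t) k) (perp (qsym (- t') l) x))) = 0"
  proof
    fix k assume "k \<in> {L..M} - {0..K}"
    then consider "k < 0" | "k > K" by auto
    then have "perp (qsym (- t) k) x = 0"
      by cases (use perp_boundD[OF x, of k "- t"] t in auto)
    then show "(\<Sum>l\<in>{0..K}.
     qsym t (a + k) * (qsym t' (b + l) * perp (qsym (- t) k) (perp (qsym (- t') l) x))) = 0"
      by (simp add: perp_commute[of "qsym (- t) k"])
  qed
qed (use S in auto)

text \<open>Commuting the inner adjoint past the multiplication yields the factor
  \<open>1 - v/u\<close>; in coefficients \<open>v/u\<close> moves \<open>(a, b)\<close> to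
  \<open>(a + 1, b - 1)\<close>.\<close>

lemma vertex_same:
  assumes t: "t = 1 \<or> t = - 1" and x: "perp_bound K x"
  shows "vertex t a (vertex t b x) = normal_ordered t t K a b x - normal_ordered t t K (a
    + 1) (b - 1) x"
proof -
  \<comment> \<open>The margin of one keeps the upper end at least \<open>K\<close> after the shift
    to \<open>M - 1\<close>.\<close>
  obtain M where M: "M \<ge> K + 1" "perp_bound M (vertex t b x)" using perp_bound_exists by blast
  let ?D = "\<lambda>k. perp (qsym (- t) k)" and ?q = "qsym t"
  have t': "- t = 1 \<or> - t = - 1" using t by auto
  have D: "?D k (vertex t b x) = (\<Sum>l\<in>{0..K}. ?q (b + l) * ?D k (?D l x))
      - (\<Sum>l\<in>{0..K}. ?q (b - 1 + l) * ?D (k - 1) (?D l x))" for k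
    unfolding vertex_eq_sum[OF x t order_refl]
    by (simp add: perp_sum perp_qsym_mult_opposite[OF t'] sum_subtractf algebra_simps)
  have "vertex t a (vertex t b x) =
      (\<Sum>k\<in>{0..M}. \<Sum>l\<in>{0..K}. ?q (a + k) * (?q (b + l) * ?D k (?D l x)))
      - (\<Sum>k\<in>{0..M}. \<Sum>l\<in>{0..K}. ?q (a + k) * (?q (b - 1 + l) * ?D (k - 1) (?D l x)))"
    unfolding vertex_eq_sum[OF M(2) t order_refl] D
    by (simp add: right_diff_distrib sum_subtractf sum_distrib_left)
  also have "(\<Sum>k\<in>{0..M}. \<Sum>l\<in>{0..K}. ?q (a + k) * (?q (b - 1 + l) * ?D (k - 1) (?D l x)))
     = (\<Sum>k\<in>{-1..M-1}. \<Sum>l\<in>{0..K}. ?q (a + 1 + k) * (?q (b - 1 + l) * ?D k (?D l x)))"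
    by (rule sum.reindex_bij_witness[of _ "\<lambda>k. k + 1" "\<lambda>k. k - 1"]) (auto simp: algebra_simps)
  also have "\<dots> = normal_ordered t t K (a + 1) (b - 1) x"
    by (rule normal_ordered_eq_sum[symmetric]) (use x t M(1) in auto)
  also have "(\<Sum>k\<in>{0..M}. \<Sum>l\<in>{0..K}. ?q (a + k) * (?q (b + l) * ?D k (?D l x)))
     = normal_ordered t t K a b x"
    by (rule normal_ordered_eq_sum[symmetric]) (use x t M(1) in auto)
  finally show ?thesis .
qed

text \<open>The relation multiplied by \<open>1 - v/u\<close>, which commits to neither expansion of
  the geometric series.\<close>

lemma vertex_opposite:
  assumes t: "t = 1 \<or> t = - 1" and x: "perp_bound K x"
  shows "vertex t a (vertex (- t) b x) - vertex t (a + 1) (vertex (- t) (b - 1) x) =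
    normal_ordered t (- t) K a b x"
proof -
  obtain M0 where M0: "M0 \<ge> K + 1" "perp_bound M0 (vertex (- t) b x)"
    using perp_bound_exists by blast
  obtain M1 where M1: "M1 \<ge> M0" "perp_bound M1 (vertex (- t) (b - 1) x)"
    using perp_bound_exists by blast
  \<comment> \<open>The shifted sum then ends exactly at \<open>M1\<close>, a bound for the second
    vector.\<close>
  define M where "M = M1 + 1"
  have M: "perp_bound M (vertex (- t) b x)" "M \<ge> K"
    using perp_bound_mono[OF M0(2), of M] M1 M0 by (auto simp: M_def)
  let ?D = "\<lambda>k. perp (qsym (- t) k)" and ?q = "qsym t"
  have t': "- t = 1 \<or> - t = - 1" using t by auto
  have D: "?D k (vertex (- t) b x) = (\<Sum>l\<in>{0..K}. qsym (- t) (b + l)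
    * ?D k (perp (qsym (- (- t)) l) x))
      + ?D (k - 1) (vertex (- t) (b - 1) x)" for k
    unfolding vertex_eq_sum[OF x t' order_refl]
    unfolding perp_sum perp_qsym_mult_same[OF t', of k]
    by (simp add: sum.distrib algebra_simps)
  have "vertex t a (vertex (- t) b x) =
      (\<Sum>k\<in>{0..M}. \<Sum>l\<in>{0..K}. ?q (a + k) * (qsym (- t) (b + l) * ?D k (perp (qsym (- (- t)) l) x)))
      + (\<Sum>k\<in>{0..M}. ?q (a + k) * ?D (k - 1) (vertex (- t) (b - 1) x))"
    unfolding vertex_eq_sum[OF M(1) t order_refl] D
    by (simp add: distrib_left sum.distrib sum_distrib_left)
  also have "(\<Sum>k\<in>{0..M}. ?q (a + k) * ?D (k - 1) (vertex (- t) (b - 1) x))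
     = (\<Sum>k\<in>{-1..M1}. ?q (a + 1 + k) * ?D k (vertex (- t) (b - 1) x))"
    by (rule sum.reindex_bij_witness[of _ "\<lambda>k. k + 1" "\<lambda>k. k - 1"])
      (auto simp: algebra_simps M_def)
  also have "\<dots> = vertex t (a + 1) (vertex (- t) (b - 1) x)"
    by (rule vertex_eq_sum[symmetric]) (use t M1 in auto)
  also have "(\<Sum>k\<in>{0..M}. \<Sum>l\<in>{0..K}. ?q (a + k) * (qsym (- t) (b + l)
    * ?D k (perp (qsym (- (- t)) l) x)))
     = normal_ordered t (- t) K a b x"
    by (rule normal_ordered_eq_sum[symmetric]) (use x t M in auto)
  finally show ?thesis by simp
qed

text \<open>By \<open>vertex_same\<close> four normally ordered terms arise, and the swap symmetry
  cancels them in pairs.\<close>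

lemma vertex_anticommute_same:
  assumes t: "t = 1 \<or> t = - 1"
  shows "vertex t a (vertex t b x) + vertex t (b - 1) (vertex t (a + 1) x) = 0"
proof -
  obtain K where x: "perp_bound K x" using perp_bound_exists by blast
  show ?thesis
    unfolding vertex_same[OF t x]
    using normal_ordered_swap[of t t K a b x] normal_ordered_swap[of t t K "a + 1" "b - 1" x]
    by simp
qed

lemma sum_int_telescope:
  fixes f :: "int \<Rightarrow> 'a::ab_group_add"
  assumes "a \<le> b"
  shows "(\<Sum>i\<in>{a..<b}. f i - f (i + 1)) = f a - f b"
  using assms
proof (induction b rule: int_ge_induct)
  case (step b)
  have "{a..<b + 1} = insert b {a..<b}" using step.hyps by auto
  then show ?case using step by simp
qed simp

lemma perp_qsym_convolution:
  assumes t: "t = 1 \<or> t = - 1"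
  shows "(\<Sum>k\<in>{0..m}. perp (qsym (- t) k) (perp (qsym t (m - k)) x)) = (if m = 0 then x else 0)"
proof -
  have "- t = 1 \<or> - t = - 1" using t by auto
  note c = qsym_convolution[OF this, of m]
  have "(\<Sum>k\<in>{0..m}. perp (qsym (- t) k) (perp (qsym t (m - k)) x)) =
      perp (\<Sum>k\<in>{0..m}. qsym (- t) k * qsym t (m - k)) x"
    by (simp add: perp_sum_left perp_mult)
  then show ?thesis using c by (cases "m = 0") auto
qed

text \<open>The sum over \<open>i\<close> sets \<open>u = v\<close> in the normally ordered product, which then collapses
  because \<open>H(u) E(-u) = 1\<close>.\<close>

lemma sum_normal_ordered:
  assumes t: "t = 1 \<or> t = - 1" and x: "perp_bound K x"
    and L: "L > \<bar>a\<bar> + \<bar>b\<bar> + \<bar>K\<bar>"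
  shows "(\<Sum>i\<in>{- L..<L}. normal_ordered t (- t) K (a + i) (b - i) x) = (if a + b = 0 then x else 0)"
proof -
  let ?D = "\<lambda>k l. perp (qsym (- t) k) (perp (qsym t l) x)"
  have conv: "(\<Sum>i\<in>{- L..<L}. qsym t (a + i + k) * qsym (- t) (b - i + l)) =
      (if a + b + k + l = 0 then 1 else 0)" if "k \<in> {0..K}" "l \<in> {0..K}" for k l
  proof -
    \<comment> \<open>Outside the smaller interval one of the two indices is negative; the choice of
      \<open>L\<close> makes the interval fit.\<close>
    have "(\<Sum>i\<in>{- L..<L}. qsym t (a + i + k) * qsym (- t) (b - i + l)) =
       (\<Sum>i\<in>{- a - k..b + l}. qsym t (a + i + k) * qsym (- t) (b - i + l))"
      by (rule sum.mono_neutral_right) (use that L in auto)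
    also have "\<dots> = (\<Sum>i\<in>{0..a + b + k + l}. qsym t i * qsym (- t) (a + b + k + l - i))"
      by (rule sum.reindex_bij_witness[of _ "\<lambda>i. i - a - k" "\<lambda>i. a + i + k"])
        (auto simp: algebra_simps)
    finally show ?thesis by (simp add: qsym_convolution[OF t])
  qed
  define m where "m = - (a + b)"
  have D0: "?D k l = 0" if "k < 0 \<or> k > K \<or> l < 0 \<or> l > K" for k l
  proof -
    have "perp (qsym (- t) k) x = 0 \<or> perp (qsym t l) x = 0"
      using that perp_boundD[OF x, of k "- t"] perp_boundD[OF x, of l t] t by auto
    then show ?thesis
    proof
      assume "perp (qsym (- t) k) x = 0"
      then show ?thesis by (simp add: perp_commute[of "qsym (- t) k"])
    qed simp
  qed
  have "(\<Sum>i\<in>{- L..<L}. normal_ordered t (- t) K (a + i) (b - i) x) =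
     (\<Sum>k\<in>{0..K}. \<Sum>l\<in>{0..K}. (\<Sum>i\<in>{- L..<L}. qsym t (a + i + k) * qsym (- t) (b - i + l)) * ?D k l)"
    unfolding normal_ordered_def
    by (subst sum.swap, rule sum.cong[OF refl], subst sum.swap)
      (simp add: sum_distrib_right mult.assoc)
  also have "\<dots> = (\<Sum>k\<in>{0..K}. \<Sum>l\<in>{0..K}. if l = m - k then ?D k l else 0)"
  proof (intro sum.cong refl)
    fix k l assume kl: "k \<in> {0..K}" "l \<in> {0..K}"
    show "(\<Sum>i\<in>{- L..<L}. qsym t (a + i + k) * qsym (- t) (b - i + l)) * ?D k l =
        (if l = m - k then ?D k l else 0)"
      unfolding conv[OF kl] by (auto simp: m_def)
  qed
  also have "\<dots> = (\<Sum>k\<in>{0..K}. ?D k (m - k))"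
    by (rule sum.cong) (use D0 in \<open>auto simp: not_le\<close>)
  \<comment> \<open>By \<open>D0\<close> only indices at which neither adjoint kills
    \<open>x\<close> count, so both ranges give the same sum.\<close>
  also have "\<dots> = (\<Sum>k\<in>{0..m}. ?D k (m - k))"
    by (rule sum.mono_neutral_cong) (use D0 in auto)
  also have "\<dots> = (if m = 0 then x else 0)"
    by (rule perp_qsym_convolution[OF t])
  finally show ?thesis by (auto simp: m_def)
qed

text \<open>\<open>?N i\<close> is a difference of consecutive \<open>?X\<close> and also of
  consecutive \<open>?Y\<close>. Telescoping the first over \<open>i \<ge> 0\<close> leaves
  \<open>?X 0\<close>, the second over \<open>i < 0\<close> leaves \<open>?Y 0\<close>; together
  they give the full sum of \<open>sum_normal_ordered\<close>.\<close>

lemma vertex_anticommute_opposite: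
  assumes t: "t = 1 \<or> t = - 1"
  shows "vertex t a (vertex (- t) b x) + vertex (- t) (b + 1) (vertex t (a - 1) x) =
    (if a + b = 0 then x else 0)"
proof -
  obtain K where x: "perp_bound K x" using perp_bound_exists by blast
  have t': "- t = 1 \<or> - t = - 1" using t by auto
  define L where "L = \<bar>a\<bar> + \<bar>b\<bar> + \<bar>K\<bar> + 1"
  let ?N = "\<lambda>i. normal_ordered t (- t) K (a + i) (b - i) x"
  let ?X = "\<lambda>i. vertex t (a + i) (vertex (- t) (b - i) x)"
  let ?Y = "\<lambda>i. vertex (- t) (b + 1 - i) (vertex t (a - 1 + i) x)"
  have N: "?N i = ?X i - ?X (i + 1)" for i
    using vertex_opposite[OF t x, of "a + i" "b - i"] by (simp add: algebra_simps)
  have N': "?N i = (- ?Y i) - (- ?Y (i + 1))" for i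
    using vertex_opposite[OF t' x, of "b - i" "a + i"] normal_ordered_swap[of t "- t" K "a
      + i" "b - i" x]
    by (simp add: algebra_simps)
  \<comment> \<open>For this \<open>L\<close> the inner index \<open>b - L\<close> lies below
    \<open>- K\<close>.\<close>
  have "?X L = 0"
    by (subst vertex_eq_0[OF x t']) (auto simp: L_def)
  moreover have "(\<Sum>i\<in>{0..<L}. ?N i) = ?X 0 - ?X L"
    unfolding N by (rule sum_int_telescope) (simp add: L_def)
  moreover have "?Y (- L) = 0"
    by (subst vertex_eq_0[OF x t]) (auto simp: L_def)
  moreover have "(\<Sum>i\<in>{- L..<0}. ?N i) = (- ?Y (- L)) - (- ?Y 0)"
    unfolding N' by (rule sum_int_telescope) (simp add: L_def)
  moreover have "(\<Sum>i\<in>{- L..<L}. ?N i) = (\<Sum>i\<in>{- L..<0}. ?N i) + (\<Sum>i\<in>{0..<L}. ?N i)"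
    by (subst sum.union_disjoint[symmetric]) (auto intro!: sum.cong simp: L_def)
  moreover have "(\<Sum>i\<in>{- L..<L}. ?N i) = (if a + b = 0 then x else 0)"
    by (rule sum_normal_ordered[OF t x]) (simp add: L_def)
  ultimately show ?thesis by simp
qed

section \<open>Linear structure of the Fock space\<close>

lemma poly_mapping_add_induct [case_names zero single add]:
  fixes b :: "'a \<Rightarrow>\<^sub>0 'b :: monoid_add"
  assumes "P 0" and "\<And>m f. P (Poly_Mapping.single m f)" and "\<And>b c. P b \<Longrightarrow> P c \<Longrightarrow> P (b + c)"
  shows "P b"
proof (induction b rule: update_induct)
  case const
  then show ?case using assms(1) by simp
next
  case (update f a b)
  have "Poly_Mapping.update a b f = f + Poly_Mapping.single a b"
    by (rule poly_mapping_eqI)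
      (use update in \<open>auto simp: lookup_update lookup_add lookup_single when_def in_keys_iff\<close>)
  then show ?case using assms(2,3) update by simp
qed

lemma fock_scale_single: "fock_scale c (Poly_Mapping.single m f)
  = Poly_Mapping.single m (sym_const c * f)"
  by (simp add: fock_scale_def mult_single)

lemma fock_scale_add: "fock_scale c (b + b') = fock_scale c b + fock_scale c b'"
  by (simp add: fock_scale_def distrib_left)

lemma fock_scale_zero [simp]: "fock_scale c 0 = 0"
  by (simp add: fock_scale_def)

lemma fock_scale_zero_left [simp]: "fock_scale 0 b = 0"
  by (simp add: fock_scale_def sym_const_def)

lemma fock_scale_one [simp]: "fock_scale 1 b = b"
  by (simp add: fock_scale_def sym_const_def)

lemma fock_scale_fock_scale: "fock_scale c (fock_scale d b) = fock_scale (c * d) b"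
  by (simp add: fock_scale_def sym_const_mult mult.assoc[symmetric] mult_single)

lemma fock_scale_add_left: "fock_scale (c + d) b = fock_scale c b + fock_scale d b"
  by (simp add: fock_scale_def sym_const_def single_add distrib_right)

lemma fock_scale_sum: "fock_scale c (sum f S) = (\<Sum>i\<in>S. fock_scale c (f i))"
  by (induction S rule: infinite_finite_induct) (auto simp: fock_scale_add)

lemma fock_scale_sum_left: "fock_scale (sum f S) b = (\<Sum>i\<in>S. fock_scale (f i) b)"
  by (induction S rule: infinite_finite_induct) (auto simp: fock_scale_add_left)

text \<open>Evaluation at the vacuum reads off the scalar from an operator identity.\<close>

lemma fock_scale_vacuum_inject:
  "fock_scale c (Poly_Mapping.single 0 1) = fock_scale d (Poly_Mapping.single 0 1) \<longleftrightarrow> c = d"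
proof
  assume "fock_scale c (Poly_Mapping.single 0 1) = fock_scale d (Poly_Mapping.single 0 1)"
  then have "Poly_Mapping.single (0 :: int) (sym_const c) = Poly_Mapping.single 0 (sym_const d)"
    unfolding fock_scale_single by (simp only: mult_1_right)
  then have "sym_const c = sym_const d" by (metis lookup_single_eq)
  then show "c = d" unfolding sym_const_def by (metis lookup_single_eq)
qed simp

section \<open>Charged free fermions\<close>

text \<open>Isolates linearity and local finiteness, so that the transformation lemmas cover both
  charges.\<close>

definition mode_family :: "(int \<Rightarrow> fock \<Rightarrow> fock) \<Rightarrow> bool" where
  "mode_family P \<longleftrightarrow> (\<forall>k b c. P k (b + c) = P k b + P k c) \<and>
     (\<forall>k x b. P k (fock_scale x b) = fock_scale x (P k b)) \<and>
     (\<forall>b. \<exists>N. \<forall>k>N. P k b = 0)"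

lemma psi_plus_superset:
  assumes "finite S" "Poly_Mapping.keys b \<subseteq> S"
  shows "psi_plus k b = (\<Sum>m\<in>S. Poly_Mapping.single (m
    + 1) (vertex 1 (- k - m) (Poly_Mapping.lookup b m)))"
  unfolding psi_plus_def HE_coeff_eq_vertex
  by (rule sum.mono_neutral_left) (use assms in \<open>auto simp: in_keys_iff\<close>)

lemma psi_minus_superset:
  assumes "finite S" "Poly_Mapping.keys b \<subseteq> S"
  shows "psi_minus k b = (\<Sum>m\<in>S. Poly_Mapping.single (m - 1) (vertex (- 1) (- k
    + m) (Poly_Mapping.lookup b m)))"
  unfolding psi_minus_def EH_coeff_eq_vertex
  by (rule sum.mono_neutral_left) (use assms in \<open>auto simp: in_keys_iff\<close>)

lemma psi_plus_single:
  "psi_plus k (Poly_Mapping.single m f) = Poly_Mapping.single (m + 1) (vertex 1 (- k - m) f)"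
  by (subst psi_plus_superset[of "{m}"]) auto

lemma psi_minus_single:
  "psi_minus k (Poly_Mapping.single m f) = Poly_Mapping.single (m - 1) (vertex (- 1) (- k + m) f)"
  by (subst psi_minus_superset[of "{m}"]) auto

lemma psi_plus_add: "psi_plus k (b + c) = psi_plus k b + psi_plus k c"
proof -
  let ?S = "Poly_Mapping.keys b \<union> Poly_Mapping.keys c"
  have "Poly_Mapping.keys (b + c) \<subseteq> ?S" by (rule Poly_Mapping.keys_add)
  then show ?thesis
    by (subst (1 2 3) psi_plus_superset[of ?S])
      (auto simp: lookup_add vertex_add single_add sum.distrib)
qed

lemma psi_minus_add: "psi_minus k (b + c) = psi_minus k b + psi_minus k c"
proof -
  let ?S = "Poly_Mapping.keys b \<union> Poly_Mapping.keys c"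
  have "Poly_Mapping.keys (b + c) \<subseteq> ?S" by (rule Poly_Mapping.keys_add)
  then show ?thesis
    by (subst (1 2 3) psi_minus_superset[of ?S])
      (auto simp: lookup_add vertex_add single_add sum.distrib)
qed

lemma mode_familyI:
  assumes add: "\<And>k b c. P k (b + c) = P k b + P k c"
    and single: "\<And>k x m f. P k (fock_scale x (Poly_Mapping.single m f)) =
      fock_scale x (P k (Poly_Mapping.single m f))"
    and ev: "\<And>m f. \<exists>N. \<forall>k>N. P k (Poly_Mapping.single m f) = 0"
  shows "mode_family P"
proof -
  have zero: "P k 0 = 0" for k using add[of k 0 0] by simp
  have "P k (fock_scale x b) = fock_scale x (P k b)" for k x b
    by (induction b rule: poly_mapping_add_induct) (auto simp: zero single add fock_scale_add)
  moreover have "\<exists>N. \<forall>k>N. P k b = 0" for b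
  proof (induction b rule: poly_mapping_add_induct)
    case (add b c)
    then obtain N M where "\<And>k. k > N \<Longrightarrow> P k b = 0" "\<And>k. k > M \<Longrightarrow> P k c = 0" by blast
    then have "\<forall>k>max N M. P k (b + c) = 0" by (simp add: assms(1))
    then show ?case by blast
  qed (use zero ev in auto)
  ultimately show ?thesis using add by (auto simp: mode_family_def)
qed

lemma mode_family_psi_plus: "mode_family psi_plus"
proof (rule mode_familyI)
  fix m f
  obtain K where K: "perp_bound K f" using perp_bound_exists by blast
  have "psi_plus k (Poly_Mapping.single m f) = 0" if "k > K - m" for k
    unfolding psi_plus_single
    by (subst vertex_eq_0[OF K]) (use that in auto)
  then show "\<exists>N. \<forall>k>N. psi_plus k (Poly_Mapping.single m f) = 0" by blast
qed (simp_all add: psi_plus_add fock_scale_single psi_plus_single vertex_scale)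

lemma mode_family_psi_minus: "mode_family psi_minus"
proof (rule mode_familyI)
  fix m f
  obtain K where K: "perp_bound K f" using perp_bound_exists by blast
  have "psi_minus k (Poly_Mapping.single m f) = 0" if "k > K + m" for k
    unfolding psi_minus_single
    by (subst vertex_eq_0[OF K]) (use that in auto)
  then show "\<exists>N. \<forall>k>N. psi_minus k (Poly_Mapping.single m f) = 0" by blast
qed (simp_all add: psi_minus_add fock_scale_single psi_minus_single vertex_scale)

lemma mode_family_zero: "mode_family P \<Longrightarrow> P k 0 = 0"
  by (metis add_cancel_right_left mode_family_def)

lemma mode_family_sum: "mode_family P \<Longrightarrow> P k (sum f S) = (\<Sum>i\<in>S. P k (f i))"
  by (induction S rule: infinite_finite_induct) (auto simp: mode_family_zero, simp add:
    mode_family_def)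

section \<open>Anticommutation relations of the untransformed modes\<close>

lemma psi_plus_anticommute: "psi_plus k (psi_plus l b) + psi_plus l (psi_plus k b) = 0"
proof (induction b rule: poly_mapping_add_induct)
  case (single m f)
  show ?case
    \<comment> \<open>The outer mode acts at charge \<open>m + 1\<close>, which accounts for the
      index shift between the two orders.\<close>
    using vertex_anticommute_same[of 1 "- k - (m + 1)" "- l - m" f]
    by (simp add: psi_plus_single single_add[symmetric] algebra_simps)
next
  case (add b c)
  have "psi_plus k (psi_plus l (b + c)) + psi_plus l (psi_plus k (b + c)) =
    (psi_plus k (psi_plus l b) + psi_plus l (psi_plus k b)) +
    (psi_plus k (psi_plus l c) + psi_plus l (psi_plus k c))"
    by (simp add: psi_plus_add algebra_simps)
  then show ?case using add by simp
qed (simp add: mode_family_zero[OF mode_family_psi_plus])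

lemma psi_minus_anticommute: "psi_minus k (psi_minus l b) + psi_minus l (psi_minus k b) = 0"
proof (induction b rule: poly_mapping_add_induct)
  case (single m f)
  show ?case
    using vertex_anticommute_same[of "- 1" "- k + (m - 1)" "- l + m" f]
    by (simp add: psi_minus_single single_add[symmetric] algebra_simps)
next
  case (add b c)
  have "psi_minus k (psi_minus l (b + c)) + psi_minus l (psi_minus k (b + c)) =
    (psi_minus k (psi_minus l b) + psi_minus l (psi_minus k b)) +
    (psi_minus k (psi_minus l c) + psi_minus l (psi_minus k c))"
    by (simp add: psi_minus_add algebra_simps)
  then show ?case using add by simp
qed (simp add: mode_family_zero[OF mode_family_psi_minus])

lemma psi_plus_minus_anticommute:
  "psi_plus k (psi_minus l b) + psi_minus l (psi_plus k b) = (if k + l = 1 then b else 0)"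
proof (induction b rule: poly_mapping_add_induct)
  case (single m f)
  have "vertex 1 (- k - (m - 1)) (vertex (- 1) (- l + m) f)
      + vertex (- 1) (- l + (m + 1)) (vertex 1 (- k - m) f) = (if k + l = 1 then f else 0)"
    \<comment> \<open>The two indices add up to \<open>1 - k - l\<close>, so the charge
      \<open>m\<close> drops out of the condition.\<close>
    using vertex_anticommute_opposite[of 1 "- k - (m - 1)" "- l + m" f]
    by (simp add: algebra_simps split: if_splits)
  then show ?case
    by (simp add: psi_plus_single psi_minus_single single_add[symmetric])
next
  case (add b c)
  have "psi_plus k (psi_minus l (b + c)) + psi_minus l (psi_plus k (b + c)) =
    (psi_plus k (psi_minus l b) + psi_minus l (psi_plus k b)) +
    (psi_plus k (psi_minus l c) + psi_minus l (psi_plus k c))"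
    by (simp add: psi_plus_add psi_minus_add algebra_simps)
  then show ?case using add by simp
qed (simp add: mode_family_zero[OF mode_family_psi_minus] mode_family_zero[OF mode_family_psi_plus])

section \<open>Linear transformations of the modes\<close>

lemma fermion_transform_eq_sum:
  assumes "\<And>i. \<bar>i\<bar> > N \<Longrightarrow> A k i = 0 \<or> P i b = 0"
  shows "fermion_transform A P k b = (\<Sum>i\<in>{- N..N}. fock_scale (A k i) (P i b))"
  unfolding fermion_transform_def
proof (rule Sum_any.expand_superset)
  show "{i. fock_scale (A k i) (P i b) \<noteq> 0} \<subseteq> {- N..N}"
  proof
    fix i assume "i \<in> {i. fock_scale (A k i) (P i b) \<noteq> 0}"
    then have "\<not> \<bar>i\<bar> > N" using assms[of i] by auto
    then show "i \<in> {- N..N}" by auto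
  qed
qed simp

lemma mode_family_uniform_bound:
  assumes "mode_family P" "finite S"
  shows "\<exists>N. \<forall>b\<in>S. \<forall>k>N. P k b = 0"
  using assms(2)
proof induction
  case (insert b S)
  then obtain N where "\<forall>b\<in>S. \<forall>k>N. P k b = 0" by blast
  moreover obtain M where "\<forall>k>M. P k b = 0" using assms(1) unfolding mode_family_def by blast
  ultimately have "\<forall>b\<in>insert b S. \<forall>k>max N M. P k b = 0" by auto
  then show ?case by blast
qed simp

text \<open>Only \<open>j\<close> in \<open>{c..J}\<close> contribute, and the finitely many vectors
  \<open>Q j b\<close> share a cutoff \<open>I\<close>. Allowing every large window lets both orders
  of composition use the same one.\<close>

lemma fermion_transform_comp:
  assumes P: "mode_family P" and Q: "mode_family Q"
    and A: "rows_bounded_below A" and B: "rows_bounded_below B"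
  shows "\<exists>N0. \<forall>N\<ge>N0. fermion_transform A P k (fermion_transform B Q l b) =
    (\<Sum>i\<in>{- N..N}. \<Sum>j\<in>{- N..N}. fock_scale (A k i * B l j) (P i (Q j b)))"
proof -
  obtain a where a: "\<And>i. i < a \<Longrightarrow> A k i = 0" using A unfolding rows_bounded_below_def by blast
  obtain c where c: "\<And>j. j < c \<Longrightarrow> B l j = 0" using B unfolding rows_bounded_below_def by blast
  obtain J where J: "\<And>j. j > J \<Longrightarrow> Q j b = 0" using Q unfolding mode_family_def by blast
  obtain I where I: "\<And>i j. i > I \<Longrightarrow> j \<in> {c..J} \<Longrightarrow> P i (Q j b) = 0"
    using mode_family_uniform_bound[OF P, of "(\<lambda>j. Q j b) ` {c..J}"] by blast
  let ?N0 = "\<bar>a\<bar> + \<bar>c\<bar> + \<bar>J\<bar> + \<bar>I\<bar>"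
  have "fermion_transform A P k (fermion_transform B Q l b) =
    (\<Sum>i\<in>{- N..N}. \<Sum>j\<in>{- N..N}. fock_scale (A k i * B l j) (P i (Q j b)))" if N: "N \<ge> ?N0" for N
  proof -
    have "B l j = 0 \<or> Q j b = 0" if "\<bar>j\<bar> > N" for j
      using c[of j] J[of j] that N by linarith
    then have 1: "fermion_transform B Q l b = (\<Sum>j\<in>{- N..N}. fock_scale (B l j) (Q j b))"
      by (rule fermion_transform_eq_sum)
    have 2: "P i (fermion_transform B Q l b)
      = (\<Sum>j\<in>{- N..N}. fock_scale (B l j) (P i (Q j b)))" for i
      unfolding 1 mode_family_sum[OF P] using P by (simp add: mode_family_def)
    have "A k i = 0 \<or> P i (fermion_transform B Q l b) = 0" if i: "\<bar>i\<bar> > N" for i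
    proof (cases "i < a")
      case False
      then have "i > I" using i N by linarith
      have "fock_scale (B l j) (P i (Q j b)) = 0" for j
        using c[of j] J[of j] I[OF \<open>i > I\<close>, of j] mode_family_zero[OF P, of i]
        by (cases "j < c"; cases "j > J") auto
      then show ?thesis unfolding 2 by simp
    qed (simp add: a)
    then have "fermion_transform A P k (fermion_transform B Q l b) =
        (\<Sum>i\<in>{- N..N}. fock_scale (A k i) (P i (fermion_transform B Q l b)))"
      by (rule fermion_transform_eq_sum)
    then show ?thesis unfolding 2 fock_scale_sum fock_scale_fock_scale .
  qed
  then show ?thesis by blast
qed

text \<open>On a common finite window the two orders add termwise. A general scalar
  \<open>\<gamma>\<close> covers equal charges (0) and opposite charges (a delta).\<close>

lemma fermion_transform_anticommutator:
  assumes P: "mode_family P" and Q: "mode_family Q"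
    and A: "rows_bounded_below A" and B: "rows_bounded_below B"
    and anti: "\<And>i j b. P i (Q j b) + Q j (P i b) = fock_scale (\<gamma> i j) b"
  shows "\<exists>N0. \<forall>N\<ge>N0. fermion_transform A P k (fermion_transform B Q l b) +
      fermion_transform B Q l (fermion_transform A P k b) =
    fock_scale (\<Sum>i\<in>{- N..N}. \<Sum>j\<in>{- N..N}. A k i * B l j * \<gamma> i j) b"
proof -
  obtain N1 where N1: "\<And>N. N \<ge> N1 \<Longrightarrow> fermion_transform A P k (fermion_transform B Q l b) =
    (\<Sum>i\<in>{- N..N}. \<Sum>j\<in>{- N..N}. fock_scale (A k i * B l j) (P i (Q j b)))"
    using fermion_transform_comp[OF P Q A B] by blast
  obtain N2 where N2: "\<And>N. N \<ge> N2 \<Longrightarrow> fermion_transform B Q l (fermion_transform A P k b) =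
    (\<Sum>j\<in>{- N..N}. \<Sum>i\<in>{- N..N}. fock_scale (B l j * A k i) (Q j (P i b)))"
    using fermion_transform_comp[OF Q P B A] by blast
  have "fermion_transform A P k (fermion_transform B Q l b) +
      fermion_transform B Q l (fermion_transform A P k b) =
    fock_scale (\<Sum>i\<in>{- N..N}. \<Sum>j\<in>{- N..N}. A k i * B l j * \<gamma> i j) b"
    if "N \<ge> max N1 N2" for N
  proof -
    have "fermion_transform B Q l (fermion_transform A P k b) =
        (\<Sum>i\<in>{- N..N}. \<Sum>j\<in>{- N..N}. fock_scale (B l j * A k i) (Q j (P i b)))"
      using N2[of N] that by (subst sum.swap) simp
    then have "fermion_transform A P k (fermion_transform B Q l b) +
        fermion_transform B Q l (fermion_transform A P k b) =
      (\<Sum>i\<in>{- N..N}. \<Sum>j\<in>{- N..N}. fock_scale (A k i * B l j) (P i (Q j b) + Q j (P i b)))"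
      using N1[of N] that by (simp add: fock_scale_add sum.distrib mult.commute)
    then show ?thesis
      by (simp add: anti fock_scale_fock_scale fock_scale_sum_left)
  qed
  then show ?thesis by blast
qed

lemma fermion_transform_anticommute:
  assumes P: "mode_family P" and A: "rows_bounded_below A"
    and anti: "\<And>i j b. P i (P j b) + P j (P i b) = 0"
  shows "fermion_transform A P k (fermion_transform A P l b) +
      fermion_transform A P l (fermion_transform A P k b) = 0"
proof -
  have "P i (P j b) + P j (P i b) = fock_scale 0 b" for i j b
    by (simp add: anti)
  from fermion_transform_anticommutator[OF P P A A this, of k l b]
  show ?thesis by auto
qed

lemma fermion_transform_psi_anticommutator:
  assumes A: "rows_bounded_below A" and B: "rows_bounded_below B"
  shows "fermion_transform A psi_plus k (fermion_transform B psi_minus l b) +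
      fermion_transform B psi_minus l (fermion_transform A psi_plus k b) =
    fock_scale (Sum_any (\<lambda>i. A k i * B l (1 - i))) b"
    and "finite {i. A k i * B l (1 - i) \<noteq> 0}"
proof -
  obtain a where a: "\<And>i. i < a \<Longrightarrow> A k i = 0" using A unfolding rows_bounded_below_def by blast
  obtain c where c: "\<And>j. j < c \<Longrightarrow> B l j = 0" using B unfolding rows_bounded_below_def by blast
  have supp: "{i. A k i * B l (1 - i) \<noteq> 0} \<subseteq> {a..1 - c}"
    using a c by (force simp: not_less[symmetric])
  then show "finite {i. A k i * B l (1 - i) \<noteq> 0}" by (rule finite_subset) simp
  have anti: "psi_plus i (psi_minus j b) + psi_minus j (psi_plus i b) =
      fock_scale (if i + j = 1 then 1 else 0) b" for i j b
    by (simp add: psi_plus_minus_anticommute)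
  obtain N0 where N0: "\<And>N. N \<ge> N0 \<Longrightarrow>
    fermion_transform A psi_plus k (fermion_transform B psi_minus l b) +
      fermion_transform B psi_minus l (fermion_transform A psi_plus k b) =
    fock_scale (\<Sum>i\<in>{- N..N}. \<Sum>j\<in>{- N..N}. A k i * B l j * (if i + j = 1 then 1 else 0)) b"
    using fermion_transform_anticommutator[OF mode_family_psi_plus mode_family_psi_minus A B anti]
    by blast
  \<comment> \<open>Large enough that the window contains the support \<open>{a..1 - c}\<close> of
    the single sum.\<close>
  define N where "N = max N0 (\<bar>a\<bar> + \<bar>c\<bar> + 1)"
  have "(\<Sum>i\<in>{- N..N}. \<Sum>j\<in>{- N..N}. A k i * B l j * (if i + j = 1 then 1 else 0)) =
     (\<Sum>i\<in>{- N..N}. A k i * B l (1 - i))"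
  proof (rule sum.cong[OF refl])
    fix i assume i: "i \<in> {- N..N}"
    have "(\<Sum>j\<in>{- N..N}. A k i * B l j * (if i + j = 1 then 1 else 0)) =
        (\<Sum>j\<in>{- N..N}. if j = 1 - i then A k i * B l j else 0)"
      by (rule sum.cong) auto
    also have "\<dots> = (if 1 - i \<in> {- N..N} then A k i * B l (1 - i) else 0)"
      by simp
    \<comment> \<open>The only \<open>i\<close> in the window with \<open>1 - i\<close> outside it
      is \<open>- N\<close>, which lies below \<open>a\<close>.\<close>
    also have "\<dots> = A k i * B l (1 - i)"
      using a[of i] i by (auto simp: N_def)
    finally show "(\<Sum>j\<in>{- N..N}. A k i * B l j * (if i + j = 1 then 1 else 0)) = A k i
      * B l (1 - i)" .
  qed
  also have "\<dots> = Sum_any (\<lambda>i. A k i * B l (1 - i))"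
    by (rule Sum_any.expand_superset[symmetric], simp, rule order_trans[OF supp])
      (auto simp: N_def)
  finally show "fermion_transform A psi_plus k (fermion_transform B psi_minus l b) +
      fermion_transform B psi_minus l (fermion_transform A psi_plus k b) =
    fock_scale (Sum_any (\<lambda>i. A k i * B l (1 - i))) b"
    using N0[of N] by (simp add: N_def)
qed

theorem proposition3p1:
  fixes A B :: "int \<Rightarrow> int \<Rightarrow> complex"
  assumes "rows_bounded_below A" and "rows_bounded_below B"
  shows "charged_free_fermions (fermion_transform A psi_plus) (fermion_transform B psi_minus)
    \<longleftrightarrow> matrix_left_inverse A (\<lambda>i j. B (1 - j) (1 - i))"
proof -
  let ?S = "\<lambda>k l. Sum_any (\<lambda>i. A k i * B l (1 - i))"
  have scaled: "(if C then b else 0) = fock_scale (if C then 1 else 0) b" for C b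
    by simp
  \<comment> \<open>The relations between equal charges hold for any \<open>A\<close> and
    \<open>B\<close> with rows bounded below, so only the mixed relation remains.\<close>
  have "charged_free_fermions (fermion_transform A psi_plus) (fermion_transform B psi_minus) \<longleftrightarrow>
      (\<forall>k l b. fock_scale (?S k l) b = (if k + l = 1 then b else 0))"
    unfolding charged_free_fermions_def fermion_transform_psi_anticommutator(1)[OF assms]
      fermion_transform_anticommute[OF mode_family_psi_plus assms(1) psi_plus_anticommute]
      fermion_transform_anticommute[OF mode_family_psi_minus assms(2) psi_minus_anticommute]
    by simp
  also have "\<dots> \<longleftrightarrow> (\<forall>k l b. fock_scale (?S k l) b = fock_scale (if k + l = 1 then 1 else 0) b)"
    unfolding scaled ..
  also have "\<dots> \<longleftrightarrow> (\<forall>k l. ?S k l = (if k + l = 1 then 1 else 0))"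
  proof (intro iffI allI)
    fix k l assume "\<forall>k l b. fock_scale (?S k l) b = fock_scale (if k + l = 1 then 1 else 0) b"
    then show "?S k l = (if k + l = 1 then 1 else 0)"
      unfolding fock_scale_vacuum_inject[symmetric] by blast
  qed simp
  \<comment> \<open>Substituting \<open>l = 1 - j\<close> turns \<open>k + l = 1\<close> into
    \<open>i = j\<close> and the sum into an entry of the matrix product.\<close>
  also have "\<dots> \<longleftrightarrow> (\<forall>i j. ?S i (1 - j) = (if i = j then 1 else 0))"
  proof safe
    fix i j assume "\<forall>k l. ?S k l = (if k + l = 1 then 1 else 0)"
    then show "?S i (1 - j) = (if i = j then 1 else 0)" by (simp del: Sum_any.cong)
  next
    fix k l assume *: "\<forall>i j. ?S i (1 - j) = (if i = j then 1 else 0)"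
    have "?S k (1 - (1 - l)) = (if k = 1 - l then 1 else 0)" using * by blast
    then show "?S k l = (if k + l = 1 then 1 else 0)" by (simp add: eq_diff_eq)
  qed
  also have "\<dots> \<longleftrightarrow> matrix_left_inverse A (\<lambda>i j. B (1 - j) (1 - i))"
    unfolding matrix_left_inverse_def
    using fermion_transform_psi_anticommutator(2)[OF assms] by simp
  finally show ?thesis .
qed

end
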